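(* Let $(\mathfrak X,+,\mathcal A)$ be a measurable Abelian semigroup with zero element. Let $d,k\in\mathbb N$, $p_{j,r}\in\mathbb R$ for $j\in\{1,\dots,k\}$ and $r\in\{1,\dots,d\}$, and $(\lambda_1,\dots,\lambda_d)\in(0,\infty)^d$. For $r\in\{1,\dots,d\}$ let $U_r$ be a probability measure on $(\mathfrak X,\mathcal A)$ and $W_r=U_r-\delta_0$. Set $R_j=\sum_{r=1}^d p_{j,r}W_r$ and $p_j=\sum_{r=1}^d|p_{j,r}|$ for $j\in\{1,\dots,k\}$, and $G=\exp\bigl(\sum_{r=1}^d\lambda_rW_r\bigr)$. Set $c_k=((2k)!)^{1/(2k)}$ and $c_k'=((2k-1)!)^{1/(4k)}$. Then, for all $u\in[0,\frac12]^k$ and $v,w\in(0,\infty)^k$, $$\Bigl\|\Bigl(\prod_{j=1}^k R_j^2\Bigr)G\Bigr\|\le\prod_{j=1}^k\Bigl(C_j\sum_{r=1}^d|p_{j,r}|\min\Bigl\{\frac{|p_{j,r}|}{\lambda_r},\,\frac4{w_j}p_j\Bigr\}\Bigr),$$ where $C_j=\max\bigl\{c_k+c_k'\frac{u_j}{v_j},\ (2(1-u_j)+c_k'u_jv_j)w_j\bigr\}$ for $j\in\{1,\dots,k\}$. In particular, for $u=0$ and $w_j=\frac{c_k}2$ for all $j\in\{1,\dots,k\}$, we obtain $$\Bigl\|\Bigl(\prod_{j=1}^k R_j^2\Bigr)G\Bigr\|\le\sqrt{(2k)!}\,\prod_{j=1}^k\Bigl(\sum_{r=1}^d|p_{j,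r}|\min\Bigl\{\frac{|p_{j,r}|}{\lambda_r},\,\frac8{c_k}p_j\Bigr\}\Bigr).$$
   Context: A measurable Abelian semigroup with zero element $(\mathfrak X,+,\mathcal A)$ is a commutative semigroup $(\mathfrak X,+)$ with identity element $0$ and a $\sigma$-algebra $\mathcal A$ on $\mathfrak X$ such that $(x,y)\mapsto x+y$ is measurable from $(\mathfrak X\times\mathfrak X,\mathcal A\otimes\mathcal A)$ to $(\mathfrak X,\mathcal A)$. $\delta_x$ is the Dirac measure at $x\in\mathfrak X$. Products and powers of finite signed measures on $(\mathfrak X,\mathcal A)$ are convolutions, $VW(A)=\int_{\mathfrak X}V(\{y\in\mathfrak X: x+y\in A\})\,dW(x)$, with empty products and zeroth powers equal to $\delta_0$; $\exp(V)=\sum_{m=0}^\infty V^m/m!$. $\|V\|=V^+(\mathfrak X)+V^-(\mathfrak X)$ is the total variation norm, where $V=V^+-V^-$ is the Hahn-Jordan decomposition. *)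

theory Defs
  imports "HOL-Probability.Probability"
begin

text \<open>
  The underlying set of the semigroup is \<open>space M\<close>, which may be any submonoid of the ambient
  commutative monoid: closure under addition is part of the measurability assumption. Of \<open>M\<close> only
  the space and the sigma-algebra are used, its measure plays no role.
\<close>

locale measurable_abelian_semigroup =
  fixes M :: "'a::comm_monoid_add measure"
  assumes zero_in_space: "0 \<in> space M"
    and add_measurable: "(\<lambda>(x, y). x + y) \<in> measurable (M \<Otimes>\<^sub>M M) M"

text \<open>
  A finite signed measure on \<open>M\<close> is represented by its real-valued set function; only the values on
  \<open>sets M\<close> are meaningful. A Hahn set is unique up to null sets, so the choice below does not
  affect the Jordan decomposition.
\<close>

definition hahn_set :: "'a measure \<Rightarrow> ('a set \<Rightarrow> real) \<Rightarrow> 'a set" where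
  "hahn_set M V = (SOME P. P \<in> sets M
     \<and> (\<forall>A\<in>sets M. A \<subseteq> P \<longrightarrow> 0 \<le> V A)
     \<and> (\<forall>A\<in>sets M. A \<inter> P = {} \<longrightarrow> V A \<le> 0))"

definition pos_part :: "'a measure \<Rightarrow> ('a set \<Rightarrow> real) \<Rightarrow> 'a measure" where
  "pos_part M V = measure_of (space M) (sets M) (\<lambda>A. ennreal (V (A \<inter> hahn_set M V)))"

definition neg_part :: "'a measure \<Rightarrow> ('a set \<Rightarrow> real) \<Rightarrow> 'a measure" where
  "neg_part M V = measure_of (space M) (sets M) (\<lambda>A. ennreal (- V (A - hahn_set M V)))"

definition tv_norm :: "'a measure \<Rightarrow> ('a set \<Rightarrow> real) \<Rightarrow> real" where
  "tv_norm M V = measure (pos_part M V) (space M) + measure (neg_part M V) (space M)"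

definition signed_integral :: "'a measure \<Rightarrow> ('a set \<Rightarrow> real) \<Rightarrow> ('a \<Rightarrow> real) \<Rightarrow> real" where
  "signed_integral M V f = (\<integral>x. f x \<partial>pos_part M V) - (\<integral>x. f x \<partial>neg_part M V)"

definition dirac :: "'a measure \<Rightarrow> 'a \<Rightarrow> 'a set \<Rightarrow> real" where
  "dirac M x = measure (return M x)"

definition conv ::
  "'a::comm_monoid_add measure \<Rightarrow> ('a set \<Rightarrow> real) \<Rightarrow> ('a set \<Rightarrow> real) \<Rightarrow> 'a set \<Rightarrow> real" where
  "conv M V W A = signed_integral M W (\<lambda>x. V {y \<in> space M. x + y \<in> A})"

fun conv_power ::
  "'a::comm_monoid_add measure \<Rightarrow> ('a set \<Rightarrow> real) \<Rightarrow> nat \<Rightarrow> 'a set \<Rightarrow> real" where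
  "conv_power M V 0 = dirac M 0"
| "conv_power M V (Suc n) = conv M V (conv_power M V n)"

text \<open>Convolution is commutative and associative, so the order of the factors is immaterial.\<close>

definition conv_prod ::
  "'a::comm_monoid_add measure \<Rightarrow> ('a set \<Rightarrow> real) list \<Rightarrow> 'a set \<Rightarrow> real" where
  "conv_prod M Vs = foldr (conv M) Vs (dirac M 0)"

text \<open>
  The exponential series converges in total variation, hence setwise to the same limit; the
  setwise limit is used as the definition.
\<close>

definition conv_exp :: "'a::comm_monoid_add measure \<Rightarrow> ('a set \<Rightarrow> real) \<Rightarrow> 'a set \<Rightarrow> real" where
  "conv_exp M V A = (\<Sum>m. conv_power M V m A / fact m)"

end

theory Submission
  imports Defs
begin

text \<open>
  Convolution polynomials and power series in the \<open>U\<^sub>r\<close> are images of absolutely summable functions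
  on the free commutative monoid of multi-indices, and this passage does not increase norms. Under it
  \<open>W\<^sub>r\<close> becomes a backward difference and \<open>G\<close> the product Poisson distribution with parameters
  \<open>\<lambda>\<^sub>r\<close>. Applying \<open>m\<close> operators \<open>\<Sum>\<^sub>r a\<^sub>i\<^sub>,\<^sub>r W\<^sub>r\<close> to the Poisson distribution gives it a density that
  is a multivariate Charlier polynomial; orthogonality bounds its second moment by
  \<open>m! \<Prod>\<^sub>i \<Sum>\<^sub>r a\<^sub>i\<^sub>,\<^sub>r\<^sup>2 / \<lambda>\<^sub>r\<close>, and Cauchy--Schwarz turns this into an \<open>L\<^sup>1\<close> bound.

  Each \<open>R\<^sub>j\<close> is split as \<open>A + B\<close>, where \<open>A\<close> collects the indices for which \<open>\<bar>p\<^sub>j\<^sub>,\<^sub>r\<bar> / \<lambda>\<^sub>r\<close> attains the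
  minimum. In \<open>R\<^sub>j\<^sup>2 = A\<^sup>2 + 2 u A B + (2 (1 - u) A + B) B\<close> every \<open>A\<close> in the first two summands is left to
  act on \<open>G\<close>, and the remaining factors are estimated by their norm. The factorials arising from
  different expansions are merged into powers of \<open>c\<^sub>k\<close> and \<open>c\<^sub>k'\<close> by log-convexity of the factorial.
\<close>

section \<open>Difference operators on multi-indices\<close>

text \<open>On the semigroup itself the measures \<open>U r\<close> may overlap or coincide, and no
  orthogonality is at hand; on the free monoid the generators are independent and the law is a
  product. Coefficients are not determined by the measure, so only one norm inequality is
  transferred back.

  Left factors of convolutions are always polynomials in the W_r, acting as compositions of finitely
  many difference operators, and the exponential stands rightmost. Thus no product of two infinite
  series is ever formed.

  Constants: a W_r estimated by its norm costs 2, two of them cost 4. If k squares yield l pairs and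
  n single factors, then 2 l + n factors act on the Poisson law. A pair is charged c_k, which is
  exact for l = k; a single factor could be charged the square root of c_k, but n >= 1 and l + n <=
  k force 2 l + n <= 2 k - 1, which leaves room for the smaller c_k'. The parameter u is the share
  of the cross term whose A acts on G, v weights the arithmetic-geometric mean inequality applied to
  that share, and w sets the threshold in the minimum.\<close>

definition shift :: "'i \<Rightarrow> ('i multiset \<Rightarrow> real) \<Rightarrow> 'i multiset \<Rightarrow> real" where
  "shift r g n = (if r \<in># n then g (n - {#r#}) else 0)"

definition diff_op :: "'i set \<Rightarrow> ('i \<Rightarrow> real) \<Rightarrow> ('i multiset \<Rightarrow> real) \<Rightarrow> 'i multiset \<Rightarrow> real" where
  "diff_op I c g n = (\<Sum>r\<in>I. c r * (shift r g n - g n))"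

definition diff_ops :: "'i set \<Rightarrow> ('i \<Rightarrow> real) list \<Rightarrow> ('i multiset \<Rightarrow> real) \<Rightarrow> 'i multiset \<Rightarrow> real" where
  "diff_ops I = foldr (diff_op I)"

text \<open>The transpose of \<open>diff_op\<close> in the pairing of summable with bounded
  functions. It moves operators from an infinite series onto a test function, where they become
  finite expressions.\<close>

definition fwd_diff :: "'i set \<Rightarrow> ('i \<Rightarrow> real) \<Rightarrow> ('i multiset \<Rightarrow> real) \<Rightarrow> 'i multiset \<Rightarrow> real" where
  "fwd_diff I c \<phi> n = (\<Sum>r\<in>I. c r * (\<phi> (add_mset r n) - \<phi> n))"

text \<open>\<open>infsum\<close> is 0 on non-summable families, so this is a norm on summable
  functions only; for real values summability is already absolute.\<close>

definition l1_norm :: "('i multiset \<Rightarrow> real) \<Rightarrow> real" where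
  "l1_norm g = (\<Sum>\<^sub>\<infinity>n. \<bar>g n\<bar>)"

definition delta0 :: "'i multiset \<Rightarrow> real" where
  "delta0 n = (if n = {#} then 1 else 0)"

lemma diff_ops_Nil [simp]: "diff_ops I [] g = g"
  and diff_ops_Cons [simp]: "diff_ops I (c # cs) g = diff_op I c (diff_ops I cs g)"
  and diff_ops_append: "diff_ops I (cs @ ds) g = diff_ops I cs (diff_ops I ds g)"
  by (simp_all add: diff_ops_def)

lemma shift_add_mset [simp]: "shift r g (add_mset r n) = g n"
  by (simp add: shift_def)

lemma shift_empty [simp]: "shift r g {#} = 0"
  by (simp add: shift_def)

lemma shift_commute: "shift r (shift s g) = shift s (shift r g)"
  by (rule ext) (auto simp: shift_def in_diff_count add_mset_commute[of r s])

lemma shift_linear: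
  "shift r (\<lambda>n. f n + g n) n = shift r f n + shift r g n"
  "shift r (\<lambda>n. f n - g n) n = shift r f n - shift r g n"
  "shift r (\<lambda>n. x * g n) n = x * shift r g n"
  "shift r (\<lambda>n. \<Sum>s\<in>J. h s n) n = (\<Sum>s\<in>J. shift r (h s) n)"
  by (simp_all add: shift_def)

lemma shift_diff_op: "shift r (diff_op I c g) = diff_op I c (shift r g)"
proof
  fix n
  have "shift r (diff_op I c g) n = (\<Sum>s\<in>I. c s * (shift r (shift s g) n - shift r g n))"
    by (simp add: diff_op_def shift_def)
  then show "shift r (diff_op I c g) n = diff_op I c (shift r g) n"
    by (simp only: diff_op_def shift_commute[of r])
qed

lemma diff_op_add:
  "diff_op I c (\<lambda>n. f n + g n) n = diff_op I c f n + diff_op I c g n"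
  by (simp add: diff_op_def shift_linear sum.distrib[symmetric] algebra_simps)

lemma diff_op_cmult: "diff_op I c (\<lambda>n. x * g n) n = x * diff_op I c g n"
  by (simp add: diff_op_def shift_linear sum_distrib_left algebra_simps)

lemma diff_op_coeff_add:
  "diff_op I (\<lambda>r. a r + b r) g n = diff_op I a g n + diff_op I b g n"
  by (simp add: diff_op_def sum.distrib[symmetric] algebra_simps)

lemma diff_op_commute: "diff_op I a (diff_op I b g) = diff_op I b (diff_op I a g)"
proof
  fix n
  \<comment> \<open>\<open>h r s\<close> is the mixed second difference of \<open>g\<close> in the
    directions \<open>r\<close> and \<open>s\<close>; commutation comes from its symmetry.\<close>
  define h where "h r s = shift s (shift r g) n - shift r g n - (shift s g n - g n)" for r s
  have *: "diff_op I a (diff_op I b g) n = (\<Sum>r\<in>I. \<Sum>s\<in>I. a r * (b s * h r s))" for a b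
  proof -
    have "shift r (diff_op I b g) n - diff_op I b g n = (\<Sum>s\<in>I. b s * h r s)" for r
      unfolding shift_diff_op
      by (simp add: diff_op_def h_def sum_subtractf[symmetric] right_diff_distrib)
    then show ?thesis
      by (simp add: diff_op_def[of I a] sum_distrib_left)
  qed
  have "(\<Sum>r\<in>I. \<Sum>s\<in>I. a r * (b s * h r s)) = (\<Sum>s\<in>I. \<Sum>r\<in>I. b s * (a r * h s r))"
    by (subst sum.swap) (intro sum.cong refl, simp add: h_def shift_commute)
  then show "diff_op I a (diff_op I b g) n = diff_op I b (diff_op I a g) n"
    unfolding * .
qed

lemma diff_op_diff_ops_commute:
  "diff_op I a (diff_ops I cs g) = diff_ops I cs (diff_op I a g)"
proof (induction cs)
  case (Cons c cs)
  then show ?case by (simp add: diff_op_commute[of I a c])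
qed simp

section \<open>Absolutely summable functions on multi-indices and summation by parts\<close>

lemma summable_on_abs_iff:
  fixes g :: "'b \<Rightarrow> real"
  shows "(\<lambda>x. \<bar>g x\<bar>) summable_on A \<longleftrightarrow> g summable_on A"
  using summable_on_iff_abs_summable_on_real[of g A] by simp

lemma summable_times_bounded:
  fixes g :: "'b \<Rightarrow> real"
  assumes "g summable_on A" "\<And>x. x \<in> A \<Longrightarrow> \<bar>\<phi> x\<bar> \<le> B"
  shows "(\<lambda>x. g x * \<phi> x) summable_on A"
proof -
  have "(\<lambda>x. B * \<bar>g x\<bar>) summable_on A"
    using assms(1) by (intro summable_on_cmult_right) (simp add: summable_on_abs_iff)
  moreover have "norm (g x * \<phi> x) \<le> B * \<bar>g x\<bar>" if "x \<in> A" for x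
    using mult_left_mono[OF assms(2)[OF that], of "\<bar>g x\<bar>"] by (simp add: abs_mult mult.commute)
  ultimately have "(\<lambda>x. norm (g x * \<phi> x)) summable_on A"
    by (intro Infinite_Sum.abs_summable_on_comparison_test'[where f = "\<lambda>x. g x * \<phi> x" and g = "\<lambda>x. B * \<bar>g x\<bar>"])
  then show ?thesis
    using summable_on_iff_abs_summable_on_real by blast
qed

text \<open>Reindexing along the injection \<open>add_mset r\<close>, outside whose range
  \<open>shift r g\<close> vanishes. This is the summation by parts behind the adjointness
  statements below.\<close>

lemma has_sum_shift_times:
  assumes "(\<lambda>n. g n * \<phi> (add_mset r n)) summable_on UNIV"
  shows "((\<lambda>n. shift r g n * \<phi> n) has_sum (\<Sum>\<^sub>\<infinity>n. g n * \<phi> (add_mset r n))) UNIV"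
proof -
  have "((\<lambda>n. shift r g n * \<phi> n) has_sum (\<Sum>\<^sub>\<infinity>n. g n * \<phi> (add_mset r n))) (range (add_mset r))"
    using has_sum_infsum[OF assms] by (subst has_sum_reindex) (simp_all add: o_def inj_def)
  moreover have "shift r g n = 0" if "n \<notin> range (add_mset r)" for n
    using that by (auto simp: shift_def image_iff dest!: multi_member_split)
  then have "((\<lambda>n. shift r g n * \<phi> n) has_sum x) (range (add_mset r)) \<longleftrightarrow>
      ((\<lambda>n. shift r g n * \<phi> n) has_sum x) UNIV" for x
    by (intro has_sum_cong_neutral) simp_all
  ultimately show ?thesis
    by blast
qed

lemma has_sum_sum:
  fixes f :: "'i \<Rightarrow> 'b \<Rightarrow> 'c :: topological_comm_monoid_add"
  assumes "\<And>i. i \<in> I \<Longrightarrow> (f i has_sum s i) A"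
  shows "((\<lambda>x. \<Sum>i\<in>I. f i x) has_sum (\<Sum>i\<in>I. s i)) A"
  using assms by (induction I rule: infinite_finite_induct) (auto intro: has_sum_add)

lemma has_sum_diff:
  fixes f g :: "'b \<Rightarrow> real"
  assumes "(f has_sum a) A" "(g has_sum b) A"
  shows "((\<lambda>x. f x - g x) has_sum (a - b)) A"
  using has_sum_add[OF assms(1) has_sum_uminusI[OF assms(2)]] by simp

lemma has_sum_diff_op_times:
  assumes "(\<lambda>n. g n * \<phi> n) summable_on UNIV"
    and "\<And>r. r \<in> I \<Longrightarrow> (\<lambda>n. g n * \<phi> (add_mset r n)) summable_on UNIV"
  shows "((\<lambda>n. diff_op I c g n * \<phi> n) has_sum (\<Sum>\<^sub>\<infinity>n. g n * fwd_diff I c \<phi> n)) UNIV"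
proof -
  have 1: "((\<lambda>n. \<Sum>r\<in>I. c r * (shift r g n * \<phi> n - g n * \<phi> n)) has_sum
     (\<Sum>r\<in>I. c r * ((\<Sum>\<^sub>\<infinity>n. g n * \<phi> (add_mset r n)) - (\<Sum>\<^sub>\<infinity>n. g n * \<phi> n)))) UNIV"
    using assms by (intro has_sum_sum has_sum_cmult_right has_sum_diff has_sum_shift_times has_sum_infsum)
  have "((\<lambda>n. \<Sum>r\<in>I. c r * (g n * \<phi> (add_mset r n) - g n * \<phi> n)) has_sum
     (\<Sum>r\<in>I. c r * ((\<Sum>\<^sub>\<infinity>n. g n * \<phi> (add_mset r n)) - (\<Sum>\<^sub>\<infinity>n. g n * \<phi> n)))) UNIV"
    using assms by (intro has_sum_sum has_sum_cmult_right has_sum_diff has_sum_infsum)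
  then have "(\<Sum>\<^sub>\<infinity>n. g n * fwd_diff I c \<phi> n) =
     (\<Sum>r\<in>I. c r * ((\<Sum>\<^sub>\<infinity>n. g n * \<phi> (add_mset r n)) - (\<Sum>\<^sub>\<infinity>n. g n * \<phi> n)))"
    by (intro infsumI) (simp add: fwd_diff_def sum_distrib_left algebra_simps)
  with 1 show ?thesis
    by (simp add: diff_op_def sum_distrib_right left_diff_distrib mult.assoc)
qed

lemma l1_norm_cmult: "l1_norm (\<lambda>n. x * g n) = \<bar>x\<bar> * l1_norm g"
  by (simp add: l1_norm_def abs_mult infsum_cmult_right')

lemma l1_norm_add:
  assumes "f summable_on UNIV" "g summable_on UNIV"
  shows "l1_norm (\<lambda>n. f n + g n) \<le> l1_norm f + l1_norm g"
proof -
  have s: "(\<lambda>n. \<bar>f n\<bar>) summable_on UNIV" "(\<lambda>n. \<bar>g n\<bar>) summable_on UNIV"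
    "(\<lambda>n. \<bar>f n + g n\<bar>) summable_on UNIV"
    using assms summable_on_add[OF assms] by (simp_all add: summable_on_abs_iff)
  have "l1_norm (\<lambda>n. f n + g n) \<le> (\<Sum>\<^sub>\<infinity>n. \<bar>f n\<bar> + \<bar>g n\<bar>)"
    unfolding l1_norm_def using s by (intro infsum_mono summable_on_add) auto
  then show ?thesis
    using s by (simp add: l1_norm_def infsum_add)
qed

lemma abs_infsum_le_l1_norm:
  assumes "g summable_on UNIV" "\<And>n. \<bar>\<phi> n\<bar> \<le> 1"
  shows "\<bar>\<Sum>\<^sub>\<infinity>n. g n * \<phi> n\<bar> \<le> l1_norm g"
proof -
  have s: "(\<lambda>n. \<bar>g n\<bar>) summable_on UNIV" "(\<lambda>n. \<bar>g n * \<phi> n\<bar>) summable_on UNIV"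
    using assms(1) summable_times_bounded[OF assms(1), of \<phi> 1] assms(2)
    by (simp_all add: summable_on_abs_iff)
  have "\<bar>\<Sum>\<^sub>\<infinity>n. g n * \<phi> n\<bar> \<le> (\<Sum>\<^sub>\<infinity>n. \<bar>g n * \<phi> n\<bar>)"
    using norm_infsum_bound[of "\<lambda>n. g n * \<phi> n" UNIV] s by simp
  also have "\<dots> \<le> l1_norm g"
    unfolding l1_norm_def using s
    by (intro infsum_mono) (auto simp: abs_mult intro: mult_left_le assms(2))
  finally show ?thesis .
qed

lemma summable_shift:
  assumes "g summable_on UNIV"
  shows "shift r g summable_on UNIV"
  using has_sum_shift_times[of g "\<lambda>_. 1" r] assms by (auto dest: has_sum_imp_summable)

lemma l1_norm_shift:
  assumes "g summable_on UNIV"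
  shows "l1_norm (shift r g) = l1_norm g"
proof -
  have "(\<lambda>n. \<bar>shift r g n\<bar>) = shift r (\<lambda>n. \<bar>g n\<bar>)"
    by (auto simp: shift_def)
  moreover have "(\<lambda>n. \<bar>g n\<bar>) summable_on UNIV"
    using assms by (simp add: summable_on_abs_iff)
  ultimately show ?thesis
    using has_sum_shift_times[of "\<lambda>n. \<bar>g n\<bar>" "\<lambda>_. 1" r]
    by (auto simp: l1_norm_def intro!: infsumI)
qed

lemma summable_diff_op:
  assumes "g summable_on UNIV"
  shows "diff_op I c g summable_on UNIV"
  using has_sum_diff_op_times[of g "\<lambda>_. 1" I c] assms by (auto dest: has_sum_imp_summable)

lemma summable_diff_ops:
  assumes "g summable_on UNIV"
  shows "diff_ops I cs g summable_on UNIV"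
  using assms by (induction cs) (auto intro: summable_diff_op)

lemma summable_on_sum:
  fixes g :: "'j \<Rightarrow> 'b \<Rightarrow> real"
  assumes "\<And>r. r \<in> I \<Longrightarrow> g r summable_on A"
  shows "(\<lambda>n. \<Sum>r\<in>I. g r n) summable_on A"
  using has_sum_sum[where I = I and f = g and A = A and s = "\<lambda>r. infsum (g r) A"] assms
  by (auto dest: has_sum_imp_summable intro: has_sum_infsum)

lemma l1_norm_sum:
  assumes "\<And>r. r \<in> I \<Longrightarrow> g r summable_on UNIV"
  shows "l1_norm (\<lambda>n. \<Sum>r\<in>I. g r n) \<le> (\<Sum>r\<in>I. l1_norm (g r))"
  using assms
proof (induction I rule: infinite_finite_induct)
  case (insert x F)
  then have "l1_norm (\<lambda>n. g x n + (\<Sum>r\<in>F. g r n)) \<le> l1_norm (g x) + l1_norm (\<lambda>n. \<Sum>r\<in>F. g r n)"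
    by (intro l1_norm_add summable_on_sum) auto
  with insert show ?case by fastforce
qed (simp_all add: l1_norm_def)

text \<open>Coefficient form of the fact that W_r has norm at most 2: \<open>shift r\<close>
  preserves the norm.\<close>

lemma l1_norm_diff_op:
  assumes "g summable_on UNIV"
  shows "l1_norm (diff_op I c g) \<le> 2 * (\<Sum>r\<in>I. \<bar>c r\<bar>) * l1_norm g"
proof -
  have s: "(\<lambda>n. shift r g n + (-1) * g n) summable_on UNIV" for r
    using assms by (intro summable_on_add summable_shift summable_on_cmult_right)
  have "diff_op I c g = (\<lambda>n. \<Sum>r\<in>I. c r * (shift r g n + (-1) * g n))"
    by (auto simp: diff_op_def)
  then have "l1_norm (diff_op I c g) \<le> (\<Sum>r\<in>I. l1_norm (\<lambda>n. c r * (shift r g n + (-1) * g n)))"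
    using s by (simp only:) (intro l1_norm_sum summable_on_cmult_right)
  also have "\<dots> \<le> (\<Sum>r\<in>I. \<bar>c r\<bar> * (2 * l1_norm g))"
  proof (rule sum_mono)
    fix r
    have "l1_norm (\<lambda>n. shift r g n + (-1) * g n) \<le> l1_norm (shift r g) + l1_norm (\<lambda>n. (-1) * g n)"
      using assms by (intro l1_norm_add summable_shift summable_on_cmult_right)
    then show "l1_norm (\<lambda>n. c r * (shift r g n + (-1) * g n)) \<le> \<bar>c r\<bar> * (2 * l1_norm g)"
      unfolding l1_norm_cmult by (intro mult_left_mono) (simp_all add: l1_norm_shift assms)
  qed
  finally show ?thesis
    by (simp add: sum_distrib_left sum_distrib_right algebra_simps)
qed

text \<open>Transposition reverses composition: the outermost operator of the \<open>foldr\<close>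
  is moved first, which produces a \<open>fold\<close>. Every step replaces the test function and
  its bound, so both are arbitrary in the induction.\<close>

lemma infsum_diff_ops_times:
  assumes "g summable_on UNIV" "\<And>n. \<bar>\<phi> n\<bar> \<le> B"
  shows "(\<Sum>\<^sub>\<infinity>n. diff_ops I cs g n * \<phi> n) = (\<Sum>\<^sub>\<infinity>n. g n * fold (fwd_diff I) cs \<phi> n)"
  using assms(2)
proof (induction cs arbitrary: \<phi> B)
  case (Cons c cs)
  have "(\<Sum>\<^sub>\<infinity>n. diff_op I c (diff_ops I cs g) n * \<phi> n) =
      (\<Sum>\<^sub>\<infinity>n. diff_ops I cs g n * fwd_diff I c \<phi> n)"
    using Cons.prems by (intro infsumI has_sum_diff_op_times summable_times_bounded[where B = B]
      summable_diff_ops assms(1))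
  also have "\<dots> = (\<Sum>\<^sub>\<infinity>n. g n * fold (fwd_diff I) cs (fwd_diff I c \<phi>) n)"
  proof (rule Cons.IH)
    fix n
    have "\<bar>fwd_diff I c \<phi> n\<bar> \<le> (\<Sum>r\<in>I. \<bar>c r * (\<phi> (add_mset r n) - \<phi> n)\<bar>)"
      unfolding fwd_diff_def by (rule sum_abs)
    also have "\<dots> \<le> (\<Sum>r\<in>I. \<bar>c r\<bar> * (2 * B))"
    proof (intro sum_mono)
      fix r
      have "\<bar>\<phi> (add_mset r n) - \<phi> n\<bar> \<le> 2 * B"
        using Cons.prems[of n] Cons.prems[of "add_mset r n"] by linarith
      then show "\<bar>c r * (\<phi> (add_mset r n) - \<phi> n)\<bar> \<le> \<bar>c r\<bar> * (2 * B)"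
        unfolding abs_mult by (intro mult_left_mono) auto
    qed
    finally show "\<bar>fwd_diff I c \<phi> n\<bar> \<le> (\<Sum>r\<in>I. \<bar>c r\<bar> * (2 * B))" .
  qed
  finally show ?case by simp
qed simp

text \<open>Forward differences commute with translations; \<open>represents_conv\<close> uses this
  to absorb the multi-index contributed by the second factor.\<close>

lemma fold_fwd_diff_translate:
  "fold (fwd_diff I) cs (\<lambda>a. \<phi> (a + b)) a = fold (fwd_diff I) cs \<phi> (a + b)"
proof (induction cs arbitrary: \<phi>)
  case (Cons c cs)
  have "fwd_diff I c (\<lambda>a. \<phi> (a + b)) = (\<lambda>a. fwd_diff I c \<phi> (a + b))"
    by (auto simp: fwd_diff_def)
  then show ?case using Cons.IH[of "fwd_diff I c \<phi>"] by simp
qed simp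

lemma has_sum_delta0_times: "((\<lambda>n. delta0 n * \<phi> n) has_sum \<phi> {#}) UNIV"
  by (rule has_sum_finite_neutralI[of "{{#}}"]) (auto simp: delta0_def)

lemma summable_delta0: "delta0 summable_on UNIV"
  using has_sum_delta0_times[of "\<lambda>_. 1"] by (auto dest: has_sum_imp_summable)

lemma l1_norm_delta0: "l1_norm delta0 = 1"
  using has_sum_delta0_times[of "\<lambda>_. 1"] 
  by (auto simp: l1_norm_def delta0_def intro!: infsumI cong: if_cong)

section \<open>The product Poisson distribution as an exponential\<close>

definition pois :: "'i set \<Rightarrow> ('i \<Rightarrow> real) \<Rightarrow> 'i multiset \<Rightarrow> real" where
  "pois I lam n =
    (if set_mset n \<subseteq> I then \<Prod>i\<in>I. exp (- lam i) * lam i ^ count n i / fact (count n i) else 0)"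

lemma pois_nonneg:
  assumes "\<And>i. i \<in> I \<Longrightarrow> 0 \<le> lam i"
  shows "0 \<le> pois I lam n"
  using assms by (auto simp: pois_def intro!: prod_nonneg)

lemma pois_empty:
  assumes "finite I"
  shows "pois I lam {#} = exp (- (\<Sum>i\<in>I. lam i))"
  using assms by (simp add: pois_def exp_sum sum_negf[symmetric])

lemma pois_add_mset:
  assumes "finite I" "r \<in> I"
  shows "Suc (count n r) * pois I lam (add_mset r n) = lam r * pois I lam n"
proof -
  have "(\<Prod>i\<in>I - {r}. exp (- lam i) * lam i ^ count (add_mset r n) i / fact (count (add_mset r n) i)) =
      (\<Prod>i\<in>I - {r}. exp (- lam i) * lam i ^ count n i / fact (count n i))"
    by (intro prod.cong) auto
  then show ?thesis
    using assms by (simp add: pois_def prod.remove[of I r] field_simps del: of_nat_Suc)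
qed

text \<open>\<open>count n r / lam r\<close> is the density of the translated Poisson law with
  respect to the law itself. The weights in \<open>creation\<close> come from here.\<close>

lemma shift_pois:
  assumes "finite I" "r \<in> I" "lam r \<noteq> 0"
  shows "shift r (pois I lam) n = count n r / lam r * pois I lam n"
proof (cases "r \<in># n")
  case True
  then obtain m where "n = add_mset r m"
    by (blast dest: multi_member_split)
  then show ?thesis
    using pois_add_mset[OF assms(1,2), of m lam] assms(3) by (simp add: field_simps)
qed (simp add: shift_def count_eq_zero_iff)

text \<open>The recurrence fixes a function on multisets over \<open>I\<close> once its value at the
  empty one is known. This identifies the exponential series without expanding powers of the
  generator.\<close>

lemma pois_unique:
  fixes f :: "'i multiset \<Rightarrow> real"
  assumes "finite I"
    and zero: "f {#} = exp (- (\<Sum>i\<in>I. lam i))"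
    and step: "\<And>n r. r \<in> I \<Longrightarrow> Suc (count n r) * f (add_mset r n) = lam r * f n"
    and outside: "\<And>n. \<not> set_mset n \<subseteq> I \<Longrightarrow> f n = 0"
  shows "f n = pois I lam n"
proof (induction n)
  case empty
  then show ?case by (simp add: zero pois_empty assms(1))
next
  case (add r n)
  show ?case
  proof (cases "r \<in> I")
    case True
    have "real (Suc (count n r)) * f (add_mset r n) = Suc (count n r) * pois I lam (add_mset r n)"
      using step[OF True, of n] pois_add_mset[OF assms(1) True, of n lam] add by simp
    then show ?thesis
      by (simp only: mult_cancel_left of_nat_eq_0_iff) simp
  next
    case False
    then show ?thesis using outside[of "add_mset r n"] by (simp add: pois_def)
  qed
qed

text \<open>
  Multiplication by \<open>count n r\<close> is a derivation for the convolution of multi-index functions, so the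
  exponential series satisfies the recurrence in \<open>pois_unique\<close>.
\<close>

lemma count_times_diff_op:
  fixes g :: "'i multiset \<Rightarrow> real"
  assumes "finite I" "r \<in> I"
  shows "real (count n r) * diff_op I c g n = diff_op I c (\<lambda>n. real (count n r) * g n) n + c r * shift r g n"
proof -
  \<comment> \<open>The count of \<open>r\<close> at \<open>n\<close> exceeds that at
    \<open>n - {#s#}\<close> by one exactly when \<open>s = r\<close>; this excess is the derivation
    term.\<close>
  have *: "count n r * shift s g n = shift s (\<lambda>n. count n r * g n) n + (if s = r then shift r g n else 0)" for s
    by (auto simp: shift_def algebra_simps dest!: multi_member_split)
  have "count n r * diff_op I c g n = (\<Sum>s\<in>I. c s * (count n r * shift s g n - count n r * g n))"
    by (simp add: diff_op_def sum_distrib_left algebra_simps)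
  also have "\<dots> = (\<Sum>s\<in>I. c s * (shift s (\<lambda>n. count n r * g n) n - count n r * g n)
      + (if s = r then c r * shift r g n else 0))"
    unfolding * by (intro sum.cong) (auto simp: algebra_simps)
  also have "\<dots> = diff_op I c (\<lambda>n. count n r * g n) n + c r * shift r g n"
    using assms by (simp add: sum.distrib diff_op_def)
  finally show ?thesis .
qed

context
  fixes I :: "'i set" and lam :: "'i \<Rightarrow> real"
  assumes finite_I: "finite I" and lam_pos: "\<And>i. i \<in> I \<Longrightarrow> 0 < lam i"
begin

definition diff_pow :: "nat \<Rightarrow> 'i multiset \<Rightarrow> real" where
  "diff_pow m = (diff_op I lam ^^ m) delta0"

lemma diff_pow_0: "diff_pow 0 = delta0"
  and diff_pow_Suc: "diff_pow (Suc m) = diff_op I lam (diff_pow m)"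
  by (simp_all add: diff_pow_def)

lemma summable_diff_pow: "diff_pow m summable_on UNIV"
  by (induction m) (auto simp: diff_pow_0 diff_pow_Suc summable_delta0 summable_diff_op)

lemma l1_norm_diff_pow: "l1_norm (diff_pow m) \<le> (2 * (\<Sum>r\<in>I. \<bar>lam r\<bar>)) ^ m"
proof (induction m)
  case (Suc m)
  then show ?case
    using l1_norm_diff_op[OF summable_diff_pow[of m], of I lam]
      mult_left_mono[OF Suc, of "2 * (\<Sum>r\<in>I. \<bar>lam r\<bar>)"]
    by (simp add: diff_pow_Suc sum_nonneg)
qed (simp add: diff_pow_0 l1_norm_delta0)

text \<open>The rule for the derivation of a power: multiplication by the count kills
  \<open>delta0\<close>, and its commutator with \<open>diff_op I lam\<close> is
  \<open>lam r\<close> times \<open>shift r\<close>, which commutes with the remaining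
  operators.\<close>

lemma count_times_diff_pow:
  assumes "r \<in> I"
  shows "count n r * diff_pow (Suc m) n = Suc m * lam r * shift r (diff_pow m) n"
proof (induction m arbitrary: n)
  case 0
  have "(\<lambda>n. real (count n r) * delta0 n) = (\<lambda>n. 0)"
    by (auto simp: delta0_def)
  then show ?case
    using count_times_diff_op[OF finite_I assms, of n lam delta0]
    by (simp add: diff_pow_0 diff_pow_Suc) (simp add: diff_op_def shift_def)
next
  case (Suc m)
  have "count n r * diff_pow (Suc (Suc m)) n =
      diff_op I lam (\<lambda>n. count n r * diff_pow (Suc m) n) n + lam r * shift r (diff_pow (Suc m)) n"
    unfolding diff_pow_Suc[of "Suc m"] by (rule count_times_diff_op[OF finite_I assms])
  also have "\<dots> = Suc m * lam r * diff_op I lam (shift r (diff_pow m)) n + lam r * shift r (diff_pow (Suc m)) n"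
    unfolding Suc.IH by (simp only: diff_op_cmult)
  also have "diff_op I lam (shift r (diff_pow m)) = shift r (diff_pow (Suc m))"
    by (simp add: diff_pow_Suc shift_diff_op)
  finally show ?case by (simp add: algebra_simps)
qed

text \<open>Dominated by the exponential series of twice the sum of the parameters. Absolute
  convergence of the double series licenses the exchanges of the sums over \<open>m\<close> and
  \<open>n\<close> below.\<close>

lemma summable_diff_pow_exp:
  assumes "\<And>n. \<bar>\<phi> n\<bar> \<le> 1"
  shows "(\<lambda>(m, n). diff_pow m n / fact m * \<phi> n) summable_on UNIV \<times> UNIV"
proof -
  define q where "q = 2 * (\<Sum>r\<in>I. \<bar>lam r\<bar>)"
  have 1: "(\<lambda>n. \<bar>diff_pow m n / fact m * \<phi> n\<bar>) summable_on UNIV" for m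
    unfolding summable_on_abs_iff
    using summable_on_cmult_right[OF summable_diff_pow[of m], of "1 / fact m"]
    by (intro summable_times_bounded[OF _ assms]) simp
  have 2: "(\<Sum>\<^sub>\<infinity>n. \<bar>diff_pow m n / fact m * \<phi> n\<bar>) \<le> q ^ m / fact m" for m
  proof -
    have "(\<Sum>\<^sub>\<infinity>n. \<bar>diff_pow m n / fact m * \<phi> n\<bar>) \<le> (\<Sum>\<^sub>\<infinity>n. (1 / fact m) * \<bar>diff_pow m n\<bar>)"
    proof (rule infsum_mono[OF 1])
      show "(\<lambda>n. (1 / fact m) * \<bar>diff_pow m n\<bar>) summable_on UNIV"
        using summable_diff_pow[of m] by (intro summable_on_cmult_right) (simp add: summable_on_abs_iff)
      show "\<bar>diff_pow m n / fact m * \<phi> n\<bar> \<le> (1 / fact m) * \<bar>diff_pow m n\<bar>" for n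
        using mult_left_le[OF assms, of "\<bar>diff_pow m n\<bar> / fact m" n] by (simp add: abs_mult)
    qed
    also have "\<dots> = (1 / fact m) * l1_norm (diff_pow m)"
      unfolding l1_norm_def by (rule infsum_cmult_right')
    also have "\<dots> \<le> (1 / fact m) * q ^ m"
      unfolding q_def by (intro mult_left_mono l1_norm_diff_pow) simp
    finally show ?thesis by simp
  qed
  have "summable (\<lambda>m. q ^ m / fact m)"
    using summable_exp[of q] by (simp add: field_simps)
  then have "(\<lambda>m. q ^ m / fact m) summable_on UNIV"
    by (subst summable_on_UNIV_nonneg_real_iff) (auto simp: q_def sum_nonneg)
  then have 3: "(\<lambda>m. norm (\<Sum>\<^sub>\<infinity>n. \<bar>diff_pow m n / fact m * \<phi> n\<bar>)) summable_on UNIV"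
    by (rule Infinite_Sum.abs_summable_on_comparison_test') (use 2 in \<open>simp add: infsum_nonneg\<close>)
  have "(\<lambda>p. norm ((\<lambda>(m, n). diff_pow m n / fact m * \<phi> n) p)) summable_on UNIV \<times> UNIV"
    unfolding Infinite_Sum.abs_summable_on_Sigma_iff using 1 3 by simp
  then show ?thesis
    by (rule abs_summable_summable)
qed

lemma diff_pow_exp_sums_pois: "(\<lambda>m. diff_pow m n / fact m) sums pois I lam n"
proof -
  have summ: "summable (\<lambda>m. diff_pow m n / fact m)" for n
  proof -
    have "(\<lambda>(n, m). diff_pow m n / fact m) summable_on UNIV \<times> UNIV"
      using summable_diff_pow_exp[of "\<lambda>_. 1"] by (subst summable_on_swap) simp
    from summable_on_SigmaD1[OF this, of n] show ?thesis
      by (simp add: summable_on_imp_summable)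
  qed
  have "(\<Sum>m. diff_pow m n / fact m) = pois I lam n"
  proof (rule pois_unique[where f = "\<lambda>n. \<Sum>m. diff_pow m n / fact m", OF finite_I])
    \<comment> \<open>At the empty multi-index every shift vanishes, so each operator merely
      multiplies by minus the sum of the parameters.\<close>
    have "diff_pow m {#} = (- (\<Sum>i\<in>I. lam i)) ^ m" for m
      by (induction m) (simp_all add: diff_pow_0 diff_pow_Suc delta0_def diff_op_def sum_negf
        sum_distrib_right[symmetric])
    then show "(\<Sum>m. diff_pow m {#} / fact m) = exp (- (\<Sum>i\<in>I. lam i))"
      by (simp add: exp_def divide_inverse mult.commute)
  next
    fix n r assume r: "r \<in> I"
    \<comment> \<open>The term \<open>m = 0\<close> lives at the empty multi-index only, so here the
      series starts at \<open>m = 1\<close>; the factor \<open>Suc m\<close> from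
      \<open>count_times_diff_pow\<close> then cancels against \<open>fact (Suc m)\<close>.\<close>
    have 0: "diff_pow 0 (add_mset r n) = 0"
      by (simp add: diff_pow_0 delta0_def)
    have "Suc (count n r) * (\<Sum>m. diff_pow m (add_mset r n) / fact m) =
        Suc (count n r) * (\<Sum>m. diff_pow (Suc m) (add_mset r n) / fact (Suc m))"
      using suminf_split_head[OF summ, of "add_mset r n"] 0 by (simp del: of_nat_Suc fact_Suc)
    also have "\<dots> = (\<Sum>m. Suc (count n r) * (diff_pow (Suc m) (add_mset r n) / fact (Suc m)))"
      using summ[of "add_mset r n"] by (intro suminf_mult[symmetric])
        (rule iffD2[OF summable_Suc_iff[of "\<lambda>m. diff_pow m (add_mset r n) / fact m"]])
    also have "\<dots> = (\<Sum>m. lam r * (diff_pow m n / fact m))"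
    proof (rule arg_cong[where f = suminf], rule ext)
      fix m
      have "Suc (count n r) * diff_pow (Suc m) (add_mset r n) = Suc m * lam r * diff_pow m n"
        using count_times_diff_pow[OF r, of "add_mset r n" m] by (simp del: of_nat_Suc)
      then show "Suc (count n r) * (diff_pow (Suc m) (add_mset r n) / fact (Suc m)) =
          lam r * (diff_pow m n / fact m)"
        by (simp add: field_simps del: of_nat_Suc)
    qed
    also have "\<dots> = lam r * (\<Sum>m. diff_pow m n / fact m)"
      by (rule suminf_mult[OF summ])
    finally show "Suc (count n r) * (\<Sum>m. diff_pow m (add_mset r n) / fact m) =
        lam r * (\<Sum>m. diff_pow m n / fact m)" .
  next
    fix n :: "'i multiset" assume n: "\<not> set_mset n \<subseteq> I"
    have "diff_pow m n = 0" for m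
      using n
    proof (induction m arbitrary: n)
      case 0
      then show ?case by (auto simp: diff_pow_0 delta0_def)
    next
      case (Suc m)
      have "shift r (diff_pow m) n = 0" if "r \<in> I" for r
      proof (cases "r \<in># n")
        case True
        then have "set_mset n = insert r (set_mset (n - {#r#}))"
          by (metis insert_DiffM set_mset_add_mset_insert)
        then show ?thesis
          using Suc.IH[of "n - {#r#}"] Suc.prems that True by (simp add: shift_def)
      qed (simp add: shift_def)
      then show ?case using Suc.IH[OF Suc.prems] by (simp add: diff_pow_Suc diff_op_def)
    qed
    then show "(\<Sum>m. diff_pow m n / fact m) = 0" by simp
  qed
  with summ[of n] show ?thesis by (simp add: sums_iff)
qed

text \<open>The double series is summed in both orders. With \<open>\<phi> n\<close> the mass of a
  fixed set under a convolution monomial, the series over \<open>m\<close> becomes the one defining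
  \<open>conv_exp\<close>.\<close>

lemma diff_pow_exp_has_sum:
  assumes "\<And>n. \<bar>\<phi> n\<bar> \<le> 1"
  shows "(\<lambda>n. pois I lam n * \<phi> n) summable_on UNIV"
    and "(\<lambda>m. (\<Sum>\<^sub>\<infinity>n. diff_pow m n * \<phi> n) / fact m) sums (\<Sum>\<^sub>\<infinity>n. pois I lam n * \<phi> n)"
proof -
  let ?f = "\<lambda>(m, n). diff_pow m n / fact m * \<phi> n"
  define S where "S = infsum ?f (UNIV \<times> UNIV)"
  have S: "(?f has_sum S) (UNIV \<times> UNIV)"
    unfolding S_def by (rule has_sum_infsum[OF summable_diff_pow_exp[OF assms]])
  then have S': "((\<lambda>(n, m). ?f (m, n)) has_sum S) (UNIV \<times> UNIV)"
    by (rule iffD1[OF has_sum_swap])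
  have "((\<lambda>m. ?f (m, n)) has_sum pois I lam n * \<phi> n) UNIV" for n
  proof -
    have "(\<lambda>m. ?f (m, n)) summable_on UNIV"
      using summable_on_SigmaD1[of "\<lambda>n m. ?f (m, n)" UNIV "\<lambda>_. UNIV" n] has_sum_imp_summable[OF S']
      by simp
    then have "((\<lambda>m. ?f (m, n)) has_sum (\<Sum>\<^sub>\<infinity>m. ?f (m, n))) UNIV"
      by (rule has_sum_infsum)
    moreover have "(\<lambda>m. ?f (m, n)) sums (pois I lam n * \<phi> n)"
      using sums_mult2[OF diff_pow_exp_sums_pois, of n "\<phi> n"] by simp
    ultimately show ?thesis
      using has_sum_imp_sums[of "\<lambda>m. ?f (m, n)" "\<Sum>\<^sub>\<infinity>m. ?f (m, n)"]
        sums_unique2[of "\<lambda>m. ?f (m, n)" "\<Sum>\<^sub>\<infinity>m. ?f (m, n)" "pois I lam n * \<phi> n"]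
      by simp
  qed
  then have n: "((\<lambda>n. pois I lam n * \<phi> n) has_sum S) UNIV"
    using has_sum_SigmaD[OF S', of "\<lambda>n. pois I lam n * \<phi> n"] by simp
  then show "(\<lambda>n. pois I lam n * \<phi> n) summable_on UNIV"
    by (rule has_sum_imp_summable)
  have "((\<lambda>n. ?f (m, n)) has_sum (\<Sum>\<^sub>\<infinity>n. diff_pow m n * \<phi> n) / fact m) UNIV" for m
    using has_sum_divide_const[OF has_sum_infsum[OF summable_times_bounded[OF summable_diff_pow[of m] assms]],
      where c = "fact m"] by simp
  then have "((\<lambda>m. (\<Sum>\<^sub>\<infinity>n. diff_pow m n * \<phi> n) / fact m) has_sum S) UNIV"
    using has_sum_SigmaD[OF S] by simp
  then show "(\<lambda>m. (\<Sum>\<^sub>\<infinity>n. diff_pow m n * \<phi> n) / fact m) sums (\<Sum>\<^sub>\<infinity>n. pois I lam n * \<phi> n)"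
    unfolding infsumI[OF n] by (rule has_sum_imp_sums)
qed

lemma summable_pois: "pois I lam summable_on UNIV"
  using diff_pow_exp_has_sum(1)[of "\<lambda>_. 1"] by simp

text \<open>The total mass is read off from the exponential series: differences annihilate the
  constant test function, so only \<open>m = 0\<close> contributes.\<close>

lemma infsum_pois: "(\<Sum>\<^sub>\<infinity>n. pois I lam n) = 1"
proof -
  have "(\<Sum>\<^sub>\<infinity>n. diff_pow m n) = (if m = 0 then 1 else 0)" for m
  proof (cases m)
    case 0
    then show ?thesis using has_sum_delta0_times[of "\<lambda>_ :: 'i multiset. 1"] by (simp add: diff_pow_0 has_sum_iff)
  next
    case (Suc k)
    have "(diff_op I lam (diff_pow k) has_sum 0) UNIV"
      using has_sum_diff_op_times[of "diff_pow k" "\<lambda>_. 1" I lam] summable_diff_pow[of k]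
      by (simp add: fwd_diff_def)
    then show ?thesis by (simp add: Suc diff_pow_Suc has_sum_iff)
  qed
  then have "(\<lambda>m. (\<Sum>\<^sub>\<infinity>n. diff_pow m n * 1) / fact m) = (\<lambda>m. if m = 0 then 1 else 0)"
    by auto
  moreover have "(\<lambda>m::nat. if m = 0 then 1 else 0 :: real) sums 1"
    using sums_single[of 0 "\<lambda>_. 1 :: real"] by simp
  ultimately show ?thesis
    using diff_pow_exp_has_sum(2)[of "\<lambda>_. 1"] sums_unique2[of "\<lambda>m. if m = 0 then 1 else 0 :: real"] by simp
qed

end

section \<open>Charlier polynomials\<close>

text \<open>A class containing the counts, closed under sums, products and translations, and
  integrable against every Poisson law. It contains all \<open>charlier\<close> polynomials, so
  integrability is never checked through moments.\<close>

definition exp_bounded :: "('i multiset \<Rightarrow> real) \<Rightarrow> bool" where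
  "exp_bounded \<phi> \<longleftrightarrow> (\<exists>C K. 0 \<le> C \<and> 1 \<le> K \<and> (\<forall>n. \<bar>\<phi> n\<bar> \<le> C * K ^ size n))"

lemma exp_boundedI:
  assumes "0 \<le> C" "1 \<le> K" "\<And>n. \<bar>\<phi> n\<bar> \<le> C * K ^ size n"
  shows "exp_bounded \<phi>"
  using assms by (auto simp: exp_bounded_def)

lemma exp_boundedE:
  assumes "exp_bounded \<phi>"
  obtains C K where "0 \<le> C" "1 \<le> K" "\<And>n. \<bar>\<phi> n\<bar> \<le> C * K ^ size n"
  using assms by (auto simp: exp_bounded_def)

lemma exp_bounded_const: "exp_bounded (\<lambda>_. x)"
  by (rule exp_boundedI[of "\<bar>x\<bar>" 1]) auto

lemma exp_bounded_mult:
  assumes "exp_bounded f" "exp_bounded g"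
  shows "exp_bounded (\<lambda>n. f n * g n)"
proof -
  obtain C K where f: "0 \<le> C" "1 \<le> K" "\<And>n. \<bar>f n\<bar> \<le> C * K ^ size n"
    using assms(1) by (rule exp_boundedE) blast
  obtain D L where g: "0 \<le> D" "1 \<le> L" "\<And>n. \<bar>g n\<bar> \<le> D * L ^ size n"
    using assms(2) by (rule exp_boundedE) blast
  show ?thesis
  proof (rule exp_boundedI)
    show "\<bar>f n * g n\<bar> \<le> (C * D) * (K * L) ^ size n" for n
      using mult_mono[OF f(3)[of n] g(3)[of n]] f g by (simp add: abs_mult power_mult_distrib mult_ac)
    show "1 \<le> K * L" using mult_mono[OF f(2) g(2)] f by simp
  qed (use f g in simp)
qed

lemma exp_bounded_add:
  fixes f g :: "'i multiset \<Rightarrow> real"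
  assumes "exp_bounded f" "exp_bounded g"
  shows "exp_bounded (\<lambda>n. f n + g n)"
proof -
  obtain C K where f: "0 \<le> C" "1 \<le> K" "\<And>n. \<bar>f n\<bar> \<le> C * K ^ size n"
    using assms(1) by (rule exp_boundedE) blast
  obtain D L where g: "0 \<le> D" "1 \<le> L" "\<And>n. \<bar>g n\<bar> \<le> D * L ^ size n"
    using assms(2) by (rule exp_boundedE) blast
  show ?thesis
  proof (rule exp_boundedI)
    fix n :: "'i multiset"
    have "C * K ^ size n \<le> C * max K L ^ size n" "D * L ^ size n \<le> D * max K L ^ size n"
      using f g by (auto intro!: mult_left_mono power_mono)
    then show "\<bar>f n + g n\<bar> \<le> (C + D) * max K L ^ size n"
      using f(3)[of n] g(3)[of n] by (simp add: distrib_right)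
  qed (use f g in auto)
qed

lemma exp_bounded_cmult: "exp_bounded f \<Longrightarrow> exp_bounded (\<lambda>n. x * f n)"
  by (rule exp_bounded_mult[OF exp_bounded_const])

lemma exp_bounded_diff:
  assumes "exp_bounded f" "exp_bounded g"
  shows "exp_bounded (\<lambda>n. f n - g n)"
  using exp_bounded_add[OF assms(1) exp_bounded_cmult[OF assms(2), of "-1"]] by simp

lemma exp_bounded_sum:
  assumes "\<And>r. r \<in> I \<Longrightarrow> exp_bounded (f r)"
  shows "exp_bounded (\<lambda>n. \<Sum>r\<in>I. f r n)"
  using assms
  by (induction I rule: infinite_finite_induct) (auto intro: exp_bounded_const exp_bounded_add)

lemma exp_bounded_count: "exp_bounded (\<lambda>n. count n r)"
proof (rule exp_boundedI[of 1 2])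
  fix n
  have "count n r \<le> 2 ^ size n"
    using count_le_size[of n r] less_exp[of "size n"] by linarith
  then show "\<bar>real (count n r)\<bar> \<le> 1 * 2 ^ size n"
    using of_nat_mono[of "count n r" "2 ^ size n", where 'a = real] by simp
qed auto

lemma exp_bounded_translate_add:
  assumes "exp_bounded f"
  shows "exp_bounded (\<lambda>n. f (add_mset r n))"
proof -
  obtain C K where f: "0 \<le> C" "1 \<le> K" "\<And>n. \<bar>f n\<bar> \<le> C * K ^ size n"
    using assms by (rule exp_boundedE) blast
  show ?thesis
    by (rule exp_boundedI[of "C * K" K]) (use f f(3)[of "add_mset r _"] in \<open>auto simp: mult_ac\<close>)
qed

lemma exp_bounded_translate_diff:
  assumes "exp_bounded f"
  shows "exp_bounded (\<lambda>n. f (n - m))"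
proof -
  obtain C K where f: "0 \<le> C" "1 \<le> K" "\<And>n. \<bar>f n\<bar> \<le> C * K ^ size n"
    using assms by (rule exp_boundedE) blast
  show ?thesis
  proof (rule exp_boundedI[of C K])
    fix n
    have "C * K ^ size (n - m) \<le> C * K ^ size n"
      using f by (intro mult_left_mono power_increasing size_mset_mono) auto
    then show "\<bar>f (n - m)\<bar> \<le> C * K ^ size n"
      using f(3)[of "n - m"] by linarith
  qed (use f in auto)
qed

text \<open>
  \<open>creation\<close> is \<open>diff_op\<close> conjugated by the Poisson weights. Together with its adjoint \<open>fwd_diff\<close> it
  satisfies the canonical commutation relation \<open>fwd_diff_creation\<close>, from which the moment bound for
  \<open>charlier\<close> follows as for a bosonic Fock space: the Gram matrix of the coefficients is all that enters.
\<close>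

definition creation :: "'i set \<Rightarrow> ('i \<Rightarrow> real) \<Rightarrow> ('i \<Rightarrow> real) \<Rightarrow> ('i multiset \<Rightarrow> real) \<Rightarrow> 'i multiset \<Rightarrow> real" where
  "creation I lam c \<phi> n = (\<Sum>r\<in>I. c r * (count n r / lam r * \<phi> (n - {#r#}) - \<phi> n))"

definition charlier :: "'i set \<Rightarrow> ('i \<Rightarrow> real) \<Rightarrow> ('i \<Rightarrow> real) list \<Rightarrow> 'i multiset \<Rightarrow> real" where
  "charlier I lam cs = foldr (creation I lam) cs (\<lambda>_. 1)"

definition gram :: "'i set \<Rightarrow> ('i \<Rightarrow> real) \<Rightarrow> ('i \<Rightarrow> real) \<Rightarrow> ('i \<Rightarrow> real) \<Rightarrow> real" where
  "gram I lam a b = (\<Sum>r\<in>I. a r * b r / lam r)"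

lemma charlier_Nil [simp]: "charlier I lam [] = (\<lambda>_. 1)"
  and charlier_Cons [simp]: "charlier I lam (c # cs) = creation I lam c (charlier I lam cs)"
  by (simp_all add: charlier_def)

lemma creation_linear:
  "creation I lam c (\<lambda>n. \<Sum>j\<in>J. x j * f j n) n = (\<Sum>j\<in>J. x j * creation I lam c (f j) n)"
  unfolding creation_def
  by (subst sum_distrib_left, subst sum.swap)
     (simp add: sum_distrib_left sum_subtractf[symmetric] algebra_simps)

lemma exp_bounded_creation:
  assumes "exp_bounded \<phi>"
  shows "exp_bounded (creation I lam c \<phi>)"
  unfolding creation_def
  using exp_bounded_cmult[OF exp_bounded_count, of "1 / lam _"]
  by (intro exp_bounded_sum exp_bounded_cmult exp_bounded_diff exp_bounded_mult
      exp_bounded_translate_diff assms) simp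

lemma exp_bounded_charlier: "exp_bounded (charlier I lam cs)"
  by (induction cs) (auto intro: exp_bounded_const exp_bounded_creation)

lemma fwd_diff_creation:
  assumes "finite I"
  shows "fwd_diff I a (creation I lam b \<phi>) n = creation I lam b (fwd_diff I a \<phi>) n + gram I lam a b * \<phi> n"
proof -
  define A where "A r s = count (add_mset r n) s / lam s * \<phi> (add_mset r n - {#s#}) - \<phi> (add_mset r n)
      - (count n s / lam s * \<phi> (n - {#s#}) - \<phi> n)" for r s
  define B where "B r s = count n s / lam s * (\<phi> (add_mset r (n - {#s#})) - \<phi> (n - {#s#}))
      - (\<phi> (add_mset r n) - \<phi> n)" for r s
  \<comment> \<open>Adding \<open>r\<close> changes the count of \<open>s\<close> only if
    \<open>r = s\<close>, and this gives the commutator. The truncated difference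
    \<open>n - {#s#}\<close> is harmless for \<open>s\<close> outside \<open>n\<close>, since there
    its weight \<open>count n s\<close> is 0.\<close>
  have AB: "A r s = B r s + (if r = s then \<phi> n / lam s else 0)" for r s
  proof (cases "s \<in># n")
    case True
    then obtain m where n: "n = add_mset s m" by (blast dest: multi_member_split)
    show ?thesis
      by (auto simp: A_def B_def n add_mset_commute[of s r] algebra_simps add_divide_distrib diff_divide_distrib)
  next
    case False
    then have "count n s = 0" by (simp add: count_eq_zero_iff)
    then show ?thesis by (auto simp: A_def B_def)
  qed
  have "fwd_diff I a (creation I lam b \<phi>) n = (\<Sum>r\<in>I. \<Sum>s\<in>I. a r * (b s * A r s))"
    by (simp add: fwd_diff_def creation_def A_def sum_distrib_left sum_subtractf[symmetric]
        right_diff_distrib)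
  also have "\<dots> = (\<Sum>r\<in>I. \<Sum>s\<in>I. a r * (b s * B r s)) + (\<Sum>r\<in>I. \<Sum>s\<in>I. a r * (b s * (if r = s then \<phi> n / lam s else 0)))"
    unfolding AB by (simp only: distrib_left sum.distrib)
  also have "(\<Sum>r\<in>I. \<Sum>s\<in>I. a r * (b s * (if r = s then \<phi> n / lam s else 0))) = gram I lam a b * \<phi> n"
  proof -
    have "(\<Sum>s\<in>I. a r * (b s * (if r = s then \<phi> n / lam s else 0))) = a r * b r / lam r * \<phi> n"
      if "r \<in> I" for r
    proof -
      have "(\<Sum>s\<in>I. a r * (b s * (if r = s then \<phi> n / lam s else 0))) =
          (\<Sum>s\<in>I. if r = s then a r * b s / lam s * \<phi> n else 0)"
        by (intro sum.cong) auto
      then show ?thesis using assms that by simp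
    qed
    then show ?thesis by (simp add: gram_def sum_distrib_right)
  qed
  also have "(\<Sum>r\<in>I. \<Sum>s\<in>I. a r * (b s * B r s)) = (\<Sum>s\<in>I. \<Sum>r\<in>I. b s * (a r * B r s))"
    by (subst sum.swap) (simp add: mult_ac)
  also have "\<dots> = creation I lam b (fwd_diff I a \<phi>) n"
  proof -
    have "(\<Sum>r\<in>I. b s * (a r * B r s)) =
        b s * (count n s / lam s * fwd_diff I a \<phi> (n - {#s#}) - fwd_diff I a \<phi> n)" for s
      unfolding fwd_diff_def sum_distrib_left sum_subtractf[symmetric]
      by (intro sum.cong refl) (simp add: B_def algebra_simps)
    then show ?thesis by (simp add: creation_def)
  qed
  finally show ?thesis .
qed

text \<open>Wick contraction: moving the difference inwards past the creation operators removes each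
  of them once at the price of a \<open>gram\<close> entry; what finally reaches the constant 1
  vanishes.\<close>

lemma fwd_diff_charlier:
  assumes "finite I"
  shows "fwd_diff I a (charlier I lam bs) n =
    (\<Sum>j<length bs. gram I lam a (bs ! j) * charlier I lam (take j bs @ drop (Suc j) bs) n)"
proof (induction bs arbitrary: n)
  case Nil
  then show ?case by (simp add: fwd_diff_def)
next
  case (Cons b bs)
  have "fwd_diff I a (charlier I lam (b # bs)) n =
      creation I lam b (fwd_diff I a (charlier I lam bs)) n + gram I lam a b * charlier I lam bs n"
    by (simp add: fwd_diff_creation[OF assms])
  also have "fwd_diff I a (charlier I lam bs) =
      (\<lambda>n. \<Sum>j<length bs. gram I lam a (bs ! j) * charlier I lam (take j bs @ drop (Suc j) bs) n)"
    using Cons.IH by auto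
  finally show ?case
    by (simp add: creation_linear sum.lessThan_Suc_shift del: sum.lessThan_Suc)
qed

lemma gram_self_nonneg:
  assumes "\<And>i. i \<in> I \<Longrightarrow> 0 < lam i"
  shows "0 \<le> gram I lam a a"
  unfolding gram_def using assms by (intro sum_nonneg) (simp add: less_imp_le)

lemma gram_le:
  assumes "\<And>i. i \<in> I \<Longrightarrow> 0 < lam i"
  shows "\<bar>gram I lam a b\<bar> \<le> sqrt (gram I lam a a) * sqrt (gram I lam b b)"
proof -
  have "gram I lam a b = (\<Sum>r\<in>I. (a r / sqrt (lam r)) * (b r / sqrt (lam r)))" for a b
    unfolding gram_def using assms by (intro sum.cong) (auto simp: less_imp_le)
  then have "(gram I lam a b)\<^sup>2 \<le> gram I lam a a * gram I lam b b"
    using Cauchy_Schwarz_ineq_sum[of "\<lambda>r. a r / sqrt (lam r)" "\<lambda>r. b r / sqrt (lam r)" I]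
    by (simp add: power2_eq_square)
  then show ?thesis
    using real_le_rsqrt[of "\<bar>gram I lam a b\<bar>" "gram I lam a a * gram I lam b b"] by (simp add: real_sqrt_mult)
qed

section \<open>Poisson integrals of Charlier polynomials\<close>

context
  fixes I :: "'i set" and lam :: "'i \<Rightarrow> real"
  assumes finite_I: "finite I" and lam_pos: "\<And>i. i \<in> I \<Longrightarrow> 0 < lam i"
begin

text \<open>Exponential tilting: up to normalisation the factor \<open>K ^ size n\<close> multiplies
  all parameters by \<open>K\<close>. This reduces the integrability of \<open>exp_bounded\<close>
  functions to \<open>summable_pois\<close>.\<close>

lemma pois_scale:
  "pois I lam n * K ^ size n = exp ((K - 1) * (\<Sum>i\<in>I. lam i)) * pois I (\<lambda>i. K * lam i) n"
proof (cases "set_mset n \<subseteq> I")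
  case True
  have "size n = (\<Sum>i\<in>I. count n i)"
    unfolding size_multiset_overloaded_eq using True finite_I
    by (intro sum.mono_neutral_left) (auto simp: count_eq_zero_iff)
  then have "K ^ size n = (\<Prod>i\<in>I. K ^ count n i)"
    by (simp add: power_sum)
  moreover have "exp ((K - 1) * (\<Sum>i\<in>I. lam i)) = (\<Prod>i\<in>I. exp ((K - 1) * lam i))"
    by (simp add: sum_distrib_left exp_sum finite_I)
  moreover have "exp (- lam i) * lam i ^ m / fact m * K ^ m =
      exp ((K - 1) * lam i) * (exp (- (K * lam i)) * (K * lam i) ^ m / fact m)" for i m
  proof -
    have "exp (- lam i) = exp ((K - 1) * lam i) * exp (- (K * lam i))"
      by (simp add: exp_add[symmetric] left_diff_distrib)
    then show ?thesis by (simp add: power_mult_distrib)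
  qed
  ultimately show ?thesis
    using True by (simp add: pois_def prod.distrib[symmetric])
qed (simp add: pois_def)

lemma summable_pois_times:
  assumes "exp_bounded \<phi>"
  shows "(\<lambda>n. pois I lam n * \<phi> n) summable_on UNIV"
proof -
  obtain C K where \<phi>: "0 \<le> C" "1 \<le> K" "\<And>n. \<bar>\<phi> n\<bar> \<le> C * K ^ size n"
    using assms by (rule exp_boundedE) blast
  have "(\<lambda>n. C * exp ((K - 1) * (\<Sum>i\<in>I. lam i)) * pois I (\<lambda>i. K * lam i) n) summable_on UNIV"
    using \<phi>(2) lam_pos by (intro summable_on_cmult_right summable_pois finite_I) auto
  moreover have "norm (pois I lam n * \<phi> n) \<le> C * exp ((K - 1) * (\<Sum>i\<in>I. lam i)) * pois I (\<lambda>i. K * lam i) n" for n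
  proof -
    have nn: "0 \<le> pois I lam n" using lam_pos by (intro pois_nonneg) (simp add: less_imp_le)
    have "norm (pois I lam n * \<phi> n) \<le> pois I lam n * (C * K ^ size n)"
      using mult_left_mono[OF \<phi>(3) nn] nn by (simp add: abs_mult)
    also have "\<dots> = C * (pois I lam n * K ^ size n)" by simp
    finally show ?thesis unfolding pois_scale by simp
  qed
  ultimately have "(\<lambda>n. norm (pois I lam n * \<phi> n)) summable_on UNIV"
    by (rule Infinite_Sum.abs_summable_on_comparison_test')
  then show ?thesis by (rule abs_summable_summable)
qed

lemma diff_op_pois_times:
  "diff_op I c (\<lambda>n. pois I lam n * \<phi> n) n = pois I lam n * creation I lam c \<phi> n"
proof -
  have "shift r (\<lambda>n. pois I lam n * \<phi> n) n = pois I lam n * (count n r / lam r * \<phi> (n - {#r#}))"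
    if "r \<in> I" for r
  proof -
    have "shift r (\<lambda>n. pois I lam n * \<phi> n) n = shift r (pois I lam) n * \<phi> (n - {#r#})"
      by (simp add: shift_def)
    then show ?thesis
      using shift_pois[OF finite_I that, of lam n] lam_pos[OF that] by simp
  qed
  then show ?thesis
    unfolding diff_op_def creation_def sum_distrib_left
    by (intro sum.cong) (auto simp: algebra_simps)
qed

lemma diff_ops_pois: "diff_ops I cs (pois I lam) = (\<lambda>n. pois I lam n * charlier I lam cs n)"
proof (induction cs)
  case (Cons c cs)
  then show ?case using diff_op_pois_times[of c "charlier I lam cs"] by auto
qed simp

lemma infsum_diff_op_pois_times:
  assumes "exp_bounded f" "exp_bounded g"
  shows "(\<Sum>\<^sub>\<infinity>n. diff_op I c (\<lambda>n. pois I lam n * f n) n * g n) =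
    (\<Sum>\<^sub>\<infinity>n. pois I lam n * f n * fwd_diff I c g n)"
  by (intro infsumI has_sum_diff_op_times)
     (simp_all add: mult.assoc summable_pois_times exp_bounded_mult exp_bounded_translate_add assms)

text \<open>The integral is the permanent of the matrix with entries \<open>gram I lam a b\<close>:
  it has \<open>fact (length as)\<close> terms, each at most the product of all norms by
  \<open>gram_le\<close>. The induction expands along the first row, transposing the first operator
  onto the second polynomial and contracting it there.\<close>

lemma infsum_pois_charlier_bound:
  assumes "length as = length bs"
  shows "\<bar>\<Sum>\<^sub>\<infinity>n. pois I lam n * charlier I lam as n * charlier I lam bs n\<bar>
    \<le> fact (length as) * (\<Prod>a\<leftarrow>as. sqrt (gram I lam a a)) * (\<Prod>b\<leftarrow>bs. sqrt (gram I lam b b))"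
  using assms
proof (induction as arbitrary: bs)
  case Nil
  then show ?case by (simp add: infsum_pois[OF finite_I lam_pos])
next
  case (Cons a as)
  define s where "s a = sqrt (gram I lam a a)" for a
  define N where "N = length as"
  have s: "0 \<le> s a" for a by (simp add: s_def gram_self_nonneg lam_pos)
  let ?rem = "\<lambda>j. take j bs @ drop (Suc j) bs"
  have len: "length bs = Suc N" using Cons.prems by (simp add: N_def)
  have "(\<Sum>\<^sub>\<infinity>n. pois I lam n * charlier I lam (a # as) n * charlier I lam bs n) =
      (\<Sum>\<^sub>\<infinity>n. diff_op I a (\<lambda>n. pois I lam n * charlier I lam as n) n * charlier I lam bs n)"
    by (simp add: diff_op_pois_times)
  also have "\<dots> = (\<Sum>\<^sub>\<infinity>n. pois I lam n * charlier I lam as n * fwd_diff I a (charlier I lam bs) n)"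
    by (rule infsum_diff_op_pois_times[OF exp_bounded_charlier exp_bounded_charlier])
  also have "\<dots> = (\<Sum>\<^sub>\<infinity>n. \<Sum>j<length bs. gram I lam a (bs ! j) *
      (pois I lam n * charlier I lam as n * charlier I lam (?rem j) n))"
    unfolding fwd_diff_charlier[OF finite_I] sum_distrib_left by (simp add: mult_ac)
  also have "\<dots> = (\<Sum>j<length bs. gram I lam a (bs ! j) *
      (\<Sum>\<^sub>\<infinity>n. pois I lam n * charlier I lam as n * charlier I lam (?rem j) n))"
    by (intro infsumI has_sum_sum has_sum_cmult_right has_sum_infsum)
       (simp add: mult.assoc summable_pois_times exp_bounded_mult exp_bounded_charlier)
  finally have eq: "(\<Sum>\<^sub>\<infinity>n. pois I lam n * charlier I lam (a # as) n * charlier I lam bs n) = \<dots>" .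
  have "\<bar>gram I lam a (bs ! j) * (\<Sum>\<^sub>\<infinity>n. pois I lam n * charlier I lam as n * charlier I lam (?rem j) n)\<bar>
      \<le> fact N * (\<Prod>a\<leftarrow>a # as. s a) * (\<Prod>b\<leftarrow>bs. s b)" if j: "j < length bs" for j
  proof -
    have "length as = length (?rem j)" using len j by (simp add: N_def)
    then have "\<bar>gram I lam a (bs ! j) * (\<Sum>\<^sub>\<infinity>n. pois I lam n * charlier I lam as n * charlier I lam (?rem j) n)\<bar>
        \<le> (s a * s (bs ! j)) * (fact N * (\<Prod>a\<leftarrow>as. s a) * (\<Prod>b\<leftarrow>?rem j. s b))"
      unfolding abs_mult s_def N_def using lam_pos
      by (intro mult_mono gram_le Cons.IH) (auto intro!: mult_nonneg_nonneg simp: gram_self_nonneg lam_pos)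
    also have "\<dots> = fact N * (s a * (\<Prod>a\<leftarrow>as. s a)) * (s (bs ! j) * (\<Prod>b\<leftarrow>?rem j. s b))"
      by simp
    also have "s (bs ! j) * (\<Prod>b\<leftarrow>?rem j. s b) = (\<Prod>b\<leftarrow>take j bs @ bs ! j # drop (Suc j) bs. s b)"
      by simp
    also have "take j bs @ bs ! j # drop (Suc j) bs = bs"
      using j by (rule id_take_nth_drop[symmetric])
    finally show ?thesis by simp
  qed
  then have "\<bar>\<Sum>\<^sub>\<infinity>n. pois I lam n * charlier I lam (a # as) n * charlier I lam bs n\<bar>
      \<le> (\<Sum>j<length bs. fact N * (\<Prod>a\<leftarrow>a # as. s a) * (\<Prod>b\<leftarrow>bs. s b))"
    unfolding eq by (intro order_trans[OF sum_abs] sum_mono) simp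
  also have "\<dots> = fact (length (a # as)) * (\<Prod>a\<leftarrow>a # as. s a) * (\<Prod>b\<leftarrow>bs. s b)"
    by (simp add: len N_def)
  finally show ?case by (simp add: s_def)
qed

lemma l1_norm_diff_ops_pois:
  "l1_norm (diff_ops I as (pois I lam)) \<le> sqrt (fact (length as)) * (\<Prod>a\<leftarrow>as. sqrt (gram I lam a a))"
proof -
  define \<phi> where "\<phi> = charlier I lam as"
  define m where "m = l1_norm (diff_ops I as (pois I lam))"
  have nn: "0 \<le> pois I lam n" for n
    using lam_pos by (intro pois_nonneg) (simp add: less_imp_le)
  have \<phi>: "exp_bounded \<phi>" unfolding \<phi>_def by (rule exp_bounded_charlier)
  have s1: "(\<lambda>n. pois I lam n * \<bar>\<phi> n\<bar>) summable_on UNIV"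
    using summable_pois_times[OF \<phi>] nn
    by (subst (asm) summable_on_abs_iff[symmetric]) (simp add: abs_mult)
  have s2: "(\<lambda>n. pois I lam n * (\<phi> n)\<^sup>2) summable_on UNIV"
    using summable_pois_times[OF exp_bounded_mult[OF \<phi> \<phi>]] by (simp add: power2_eq_square)
  have m: "m = (\<Sum>\<^sub>\<infinity>n. pois I lam n * \<bar>\<phi> n\<bar>)"
    using nn by (simp add: m_def l1_norm_def diff_ops_pois \<phi>_def abs_mult)
  \<comment> \<open>Cauchy-Schwarz for a law of mass 1, in the form that
    \<open>\<bar>\<phi>\<bar>\<close> has nonnegative variance about its mean
    \<open>m\<close>.\<close>
  have "((\<lambda>n. pois I lam n * (\<phi> n)\<^sup>2 - 2 * m * (pois I lam n * \<bar>\<phi> n\<bar>) + m\<^sup>2 * pois I lam n) has_sum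
      (\<Sum>\<^sub>\<infinity>n. pois I lam n * (\<phi> n)\<^sup>2) - 2 * m * m + m\<^sup>2 * 1) UNIV"
    using s1 s2 summable_pois[OF finite_I lam_pos] infsum_pois[OF finite_I lam_pos] unfolding m
    by (intro has_sum_add has_sum_diff has_sum_cmult_right) (auto simp: has_sum_iff)
  then have "0 \<le> (\<Sum>\<^sub>\<infinity>n. pois I lam n * (\<phi> n)\<^sup>2) - 2 * m * m + m\<^sup>2 * 1"
  proof (rule has_sum_nonneg)
    fix n
    have "pois I lam n * (\<phi> n)\<^sup>2 - 2 * m * (pois I lam n * \<bar>\<phi> n\<bar>) + m\<^sup>2 * pois I lam n =
        pois I lam n * (\<bar>\<phi> n\<bar> - m)\<^sup>2"
      by (simp add: power2_diff algebra_simps)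
    then show "0 \<le> pois I lam n * (\<phi> n)\<^sup>2 - 2 * m * (pois I lam n * \<bar>\<phi> n\<bar>) + m\<^sup>2 * pois I lam n"
      using nn by simp
  qed
  then have "m\<^sup>2 \<le> (\<Sum>\<^sub>\<infinity>n. pois I lam n * (\<phi> n)\<^sup>2)"
    by (simp add: power2_eq_square)
  also have "\<dots> \<le> fact (length as) * (\<Prod>a\<leftarrow>as. sqrt (gram I lam a a))\<^sup>2"
    using infsum_pois_charlier_bound[of as as] by (simp add: \<phi>_def power2_eq_square mult.assoc)
  finally have "m \<le> sqrt (fact (length as) * (\<Prod>a\<leftarrow>as. sqrt (gram I lam a a))\<^sup>2)"
    by (rule real_le_rsqrt)
  moreover have "0 \<le> (\<Prod>a\<leftarrow>as. sqrt (gram I lam a a))"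
    by (induction as) (auto simp: gram_self_nonneg lam_pos)
  ultimately show ?thesis by (simp add: m_def real_sqrt_mult)
qed

end

section \<open>Integration against a signed measure\<close>

lemma borel_measurable_sets_eq:
  "f \<in> borel_measurable M \<Longrightarrow> sets N = sets M \<Longrightarrow> f \<in> borel_measurable N"
  by (simp cong: measurable_cong_sets)

text \<open>An equality of differences of measures, kept additive because subtraction in
  \<open>ennreal\<close> is truncated and because sums pass through the induction over measurable
  functions.\<close>

lemma nn_integral_add_measure_eq:
  assumes sets: "sets a = sets M" "sets b = sets M" "sets c = sets M" "sets d = sets M"
    and eq: "\<forall>A\<in>sets M. emeasure a A + emeasure b A = emeasure c A + emeasure d A"
    and f: "f \<in> borel_measurable M"
  shows "(\<integral>\<^sup>+x. f x \<partial>a) + (\<integral>\<^sup>+x. f x \<partial>b) = (\<integral>\<^sup>+x. f x \<partial>c) + (\<integral>\<^sup>+x. f x \<partial>d)"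
  using f
proof (induction rule: borel_measurable_induct)
  case (cong f g)
  have "(\<integral>\<^sup>+x. f x \<partial>N) = (\<integral>\<^sup>+x. g x \<partial>N)" if "sets N = sets M" for N
    using cong sets_eq_imp_space_eq[OF that] by (intro nn_integral_cong) simp
  with cong sets show ?case by simp
next
  case (set A)
  with sets eq show ?case by simp
next
  case (mult u x)
  have "u \<in> borel_measurable N" if "sets N = sets M" for N
    using mult(2) that by (rule borel_measurable_sets_eq)
  with mult sets show ?case by (simp add: nn_integral_cmult distrib_left[symmetric])
next
  case (add u v)
  have uv: "u \<in> borel_measurable M" "v \<in> borel_measurable M"
    using add by simp_all
  have eq: "(\<integral>\<^sup>+x. v x + u x \<partial>N) = (\<integral>\<^sup>+x. v x \<partial>N) + (\<integral>\<^sup>+x. u x \<partial>N)" if "sets N = sets M" for N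
    using borel_measurable_sets_eq[OF uv(2) that] borel_measurable_sets_eq[OF uv(1) that]
    by (rule nn_integral_add)
  have swap: "(x + y) + (z + w) = (x + z) + (y + w)" for x y z w :: ennreal
    by (simp add: ac_simps)
  have "integral\<^sup>N a u + integral\<^sup>N b u = integral\<^sup>N c u + integral\<^sup>N d u"
    "integral\<^sup>N a v + integral\<^sup>N b v = integral\<^sup>N c v + integral\<^sup>N d v"
    using add by simp_all
  then show ?case
    unfolding eq[OF sets(1)] eq[OF sets(2)] eq[OF sets(3)] eq[OF sets(4)] by (metis swap)
next
  case (seq F)
  have *: "(\<integral>\<^sup>+x. (\<Squnion>i. F i) x \<partial>N) = (\<Squnion>i. \<integral>\<^sup>+x. F i x \<partial>N)"
      "incseq (\<lambda>i. \<integral>\<^sup>+x. F i x \<partial>N)" if "sets N = sets M" for N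
  proof -
    have "F i \<in> borel_measurable N" for i
      using seq(1) that by (rule borel_measurable_sets_eq)
    then show "(\<integral>\<^sup>+x. (\<Squnion>i. F i) x \<partial>N) = (\<Squnion>i. \<integral>\<^sup>+x. F i x \<partial>N)"
      unfolding SUP_apply by (rule nn_integral_monotone_convergence_SUP[OF seq(3)])
    show "incseq (\<lambda>i. \<integral>\<^sup>+x. F i x \<partial>N)"
      using seq(3) by (auto simp: incseq_def le_fun_def intro!: nn_integral_mono)
  qed
  show ?case
    unfolding *(1)[OF sets(1)] *(1)[OF sets(2)] *(1)[OF sets(3)] *(1)[OF sets(4)]
    using seq by (simp add: ennreal_SUP_add[symmetric] *(2) sets)
qed

lemma integral_add_measure_eq:
  fixes h :: "'a \<Rightarrow> real"
  assumes sets: "sets a = sets M" "sets b = sets M" "sets c = sets M" "sets d = sets M"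
    and fin: "finite_measure a" "finite_measure b" "finite_measure c" "finite_measure d"
    and eq: "\<forall>A\<in>sets M. emeasure a A + emeasure b A = emeasure c A + emeasure d A"
    and h: "h \<in> borel_measurable M" "\<And>x. \<bar>h x\<bar> \<le> B"
  shows "(\<integral>x. h x \<partial>a) + (\<integral>x. h x \<partial>b) = (\<integral>x. h x \<partial>c) + (\<integral>x. h x \<partial>d)"
proof -
  have int: "integrable N h" if "sets N = sets M" "finite_measure N" for N
    using that h borel_measurable_sets_eq[OF h(1) that(1)]
    by (intro finite_measure.integrable_const_bound[where B = B]) auto
  \<comment> \<open>Adding \<open>B\<close> makes the integrand nonnegative; the resulting multiples
    of the total masses cancel at the end by \<open>eq\<close> for the whole space.\<close>
  have nn: "(\<integral>\<^sup>+x. ennreal (h x + B) \<partial>N) = ennreal ((\<integral>x. h x \<partial>N) + B * measure N (space M))"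
      and nonneg: "0 \<le> (\<integral>x. h x \<partial>N) + B * measure N (space M)"
    if N: "sets N = sets M" "finite_measure N" for N
  proof -
    interpret finite_measure N by fact
    have nn: "0 \<le> h x + B" for x using h(2)[of x] by linarith
    have eq: "(\<integral>x. h x \<partial>N) + B * measure N (space M) = (\<integral>x. h x + B \<partial>N)"
      using int[OF N] by (simp add: mult.commute sets_eq_imp_space_eq[OF N(1)])
    show "(\<integral>\<^sup>+x. ennreal (h x + B) \<partial>N) = ennreal ((\<integral>x. h x \<partial>N) + B * measure N (space M))"
      unfolding eq by (intro nn_integral_eq_integral) (use int[OF N] nn in auto)
    show "0 \<le> (\<integral>x. h x \<partial>N) + B * measure N (space M)"
      unfolding eq by (intro integral_nonneg_AE) (use nn in auto)
  qed
  have "(\<lambda>x. ennreal (h x + B)) \<in> borel_measurable M"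
    using h by simp
  from nn_integral_add_measure_eq[OF sets eq this]
  have "((\<integral>x. h x \<partial>a) + B * measure a (space M)) + ((\<integral>x. h x \<partial>b) + B * measure b (space M)) =
      ((\<integral>x. h x \<partial>c) + B * measure c (space M)) + ((\<integral>x. h x \<partial>d) + B * measure d (space M))"
    using sets fin nonneg by (simp add: nn ennreal_plus[symmetric] del: ennreal_plus)
  moreover have "measure a (space M) + measure b (space M) = measure c (space M) + measure d (space M)"
    using bspec[OF eq, of "space M"] fin
    by (simp add: finite_measure.emeasure_eq_measure ennreal_plus[symmetric] del: ennreal_plus)
  then have "B * measure a (space M) + B * measure b (space M) = B * measure c (space M) + B * measure d (space M)"
    by (simp flip: distrib_left)
  ultimately show ?thesis by linarith
qed

section \<open>Jordan decomposition of a difference of two finite measures\<close>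

lemma hahn_set_props:
  assumes sets: "sets \<mu> = sets M" "sets \<nu> = sets M"
    and fin: "finite_measure \<mu>" "finite_measure \<nu>"
    and V: "\<forall>A\<in>sets M. V A = measure \<mu> A - measure \<nu> A"
  shows "hahn_set M V \<in> sets M"
    and "\<And>A. A \<in> sets M \<Longrightarrow> A \<subseteq> hahn_set M V \<Longrightarrow> 0 \<le> V A"
    and "\<And>A. A \<in> sets M \<Longrightarrow> A \<inter> hahn_set M V = {} \<Longrightarrow> V A \<le> 0"
proof -
  obtain P where "P \<in> sets \<mu>" "\<forall>X\<in>sets \<mu>. X \<subseteq> P \<longrightarrow> emeasure \<nu> X \<le> emeasure \<mu> X"
    "\<forall>X\<in>sets \<mu>. X \<inter> P = {} \<longrightarrow> emeasure \<mu> X \<le> emeasure \<nu> X"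
    using finite_unsigned_Hahn_decomposition[OF fin] sets by auto
  then have "P \<in> sets M \<and> (\<forall>A\<in>sets M. A \<subseteq> P \<longrightarrow> 0 \<le> V A) \<and> (\<forall>A\<in>sets M. A \<inter> P = {} \<longrightarrow> V A \<le> 0)"
    using sets fin V by (simp add: finite_measure.emeasure_eq_measure)
  then have "hahn_set M V \<in> sets M \<and> (\<forall>A\<in>sets M. A \<subseteq> hahn_set M V \<longrightarrow> 0 \<le> V A)
      \<and> (\<forall>A\<in>sets M. A \<inter> hahn_set M V = {} \<longrightarrow> V A \<le> 0)"
    unfolding hahn_set_def by (rule someI)
  then show "hahn_set M V \<in> sets M"
    "\<And>A. A \<in> sets M \<Longrightarrow> A \<subseteq> hahn_set M V \<Longrightarrow> 0 \<le> V A"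
    "\<And>A. A \<in> sets M \<Longrightarrow> A \<inter> hahn_set M V = {} \<Longrightarrow> V A \<le> 0" by blast+
qed

text \<open>\<open>measure_of\<close> returns the prescribed values only for a countably additive
  set function. Additivity is inherited from \<open>diff_measure\<close>, applied to both measures
  restricted to \<open>Q\<close>, where one dominates the other.\<close>

lemma measure_of_restricted_diff:
  assumes sets: "sets \<mu> = sets M" "sets \<nu> = sets M"
    and fin: "finite_measure \<mu>" "finite_measure \<nu>"
    and Q: "Q \<in> sets M"
    and le: "\<And>A. A \<in> sets M \<Longrightarrow> A \<subseteq> Q \<Longrightarrow> measure \<nu> A \<le> measure \<mu> A"
    and f: "\<And>A. A \<in> sets M \<Longrightarrow> f A = measure \<mu> (A \<inter> Q) - measure \<nu> (A \<inter> Q)"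
    and A: "A \<in> sets M"
  shows "emeasure (measure_of (space M) (sets M) (\<lambda>A. ennreal (f A))) A = ennreal (f A)"
proof -
  define \<mu>' where "\<mu>' = density \<mu> (indicator Q)"
  define \<nu>' where "\<nu>' = density \<nu> (indicator Q)"
  have em: "emeasure \<mu>' A = ennreal (measure \<mu> (A \<inter> Q))" "emeasure \<nu>' A = ennreal (measure \<nu> (A \<inter> Q))"
    if "A \<in> sets M" for A
    using that Q sets fin
    by (simp_all add: \<mu>'_def \<nu>'_def emeasure_restricted finite_measure.emeasure_eq_measure Int_commute)
  have s': "sets \<mu>' = sets M" "sets \<nu>' = sets M"
    using sets by (simp_all add: \<mu>'_def \<nu>'_def)
  have "space \<mu>' = space M" "space \<nu>' = space M"
    using s' sets_eq_imp_space_eq by blast+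
  then have fin': "finite_measure \<mu>'" "finite_measure \<nu>'"
    using em[of "space M"] by (auto intro!: finite_measureI)
  have D: "emeasure (diff_measure \<mu>' \<nu>') A = ennreal (f A)" if "A \<in> sets M" for A
  proof -
    have "emeasure (diff_measure \<mu>' \<nu>') A = emeasure \<mu>' A - emeasure \<nu>' A"
      using s' that le Q by (intro emeasure_diff_measure fin') (auto simp: em intro!: ennreal_leI)
    then show ?thesis
      using that f by (simp add: em ennreal_minus)
  qed
  have "measure_of (space M) (sets M) (\<lambda>A. ennreal (f A)) =
      measure_of (space M) (sets M) (emeasure (diff_measure \<mu>' \<nu>'))"
    by (intro measure_of_eq sets.space_closed) (simp add: D sets.sigma_sets_eq)
  also have "\<dots> = diff_measure \<mu>' \<nu>'"
    using measure_of_of_measure[of "diff_measure \<mu>' \<nu>'"] s' \<open>space \<mu>' = space M\<close> by simp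
  finally show ?thesis using D A by simp
qed

lemma emeasure_pos_neg_part:
  assumes sets: "sets \<mu> = sets M" "sets \<nu> = sets M"
    and fin: "finite_measure \<mu>" "finite_measure \<nu>"
    and V: "\<forall>A\<in>sets M. V A = measure \<mu> A - measure \<nu> A"
    and A: "A \<in> sets M"
  shows "emeasure (pos_part M V) A = ennreal (V (A \<inter> hahn_set M V))"
    and "emeasure (neg_part M V) A = ennreal (- V (A - hahn_set M V))"
proof -
  note H = hahn_set_props[OF sets fin V]
  show "emeasure (pos_part M V) A = ennreal (V (A \<inter> hahn_set M V))"
    unfolding pos_part_def
    by (rule measure_of_restricted_diff[OF sets fin H(1) _ _ A]) (use H V in auto)
  have sub: "A - hahn_set M V = A \<inter> (space M - hahn_set M V)" if "A \<in> sets M" for A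
    using sets.sets_into_space[OF that] by auto
  show "emeasure (neg_part M V) A = ennreal (- V (A - hahn_set M V))"
    unfolding neg_part_def
  proof (rule measure_of_restricted_diff[OF sets(2,1) fin(2,1) _ _ _ A])
    show Q: "space M - hahn_set M V \<in> sets M" using H(1) by simp
    show "measure \<mu> B \<le> measure \<nu> B" if "B \<in> sets M" "B \<subseteq> space M - hahn_set M V" for B
      using H(3)[OF that(1)] V that by auto
    show "- V (B - hahn_set M V) = measure \<nu> (B \<inter> (space M - hahn_set M V)) - measure \<mu> (B \<inter> (space M - hahn_set M V))"
      if "B \<in> sets M" for B
      using V that Q by (simp add: sub[OF that] sets.Int)
  qed
qed

text \<open>The positive part plus \<open>\<nu>\<close> equals the negative part plus
  \<open>\<mu>\<close>, so the chosen Hahn set drops out and any decomposition, minimal or not,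
  computes the integral.\<close>

lemma signed_integral_eq:
  fixes h :: "'a \<Rightarrow> real"
  assumes sets: "sets \<mu> = sets M" "sets \<nu> = sets M"
    and fin: "finite_measure \<mu>" "finite_measure \<nu>"
    and V: "\<forall>A\<in>sets M. V A = measure \<mu> A - measure \<nu> A"
    and h: "h \<in> borel_measurable M" "\<And>x. \<bar>h x\<bar> \<le> B"
  shows "signed_integral M V h = (\<integral>x. h x \<partial>\<mu>) - (\<integral>x. h x \<partial>\<nu>)"
proof -
  note E = emeasure_pos_neg_part[OF sets fin V]
  note H = hahn_set_props[OF sets fin V]
  have s: "sets (pos_part M V) = sets M" "sets (neg_part M V) = sets M"
    by (simp_all add: pos_part_def neg_part_def)
  then have sp: "space (pos_part M V) = space M" "space (neg_part M V) = space M"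
    using sets_eq_imp_space_eq by blast+
  have f: "finite_measure (pos_part M V)" "finite_measure (neg_part M V)"
    using E[of "space M"] sp by (auto intro!: finite_measureI)
  have "(\<integral>x. h x \<partial>pos_part M V) + (\<integral>x. h x \<partial>\<nu>) = (\<integral>x. h x \<partial>neg_part M V) + (\<integral>x. h x \<partial>\<mu>)"
  proof (rule integral_add_measure_eq[OF s(1) sets(2) s(2) sets(1) f(1) fin(2) f(2) fin(1) _ h], rule ballI)
    fix A assume A: "A \<in> sets M"
    let ?P = "hahn_set M V"
    have AP: "A \<inter> ?P \<in> sets M" "A - ?P \<in> sets M" using A H(1) by auto
    have split: "measure N A = measure N (A \<inter> ?P) + measure N (A - ?P)"
      if "sets N = sets M" "finite_measure N" for N
      using that AP finite_measure.finite_measure_Union[OF that(2), of "A \<inter> ?P" "A - ?P"]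
      by (simp add: Int_Diff_disjoint Int_Diff_Un)
    have nn: "0 \<le> V (A \<inter> ?P)" "V (A - ?P) \<le> 0" using H(2,3) AP by auto
    have "V (A \<inter> ?P) + measure \<nu> A = - V (A - ?P) + measure \<mu> A"
      using V AP split[OF sets(1) fin(1)] split[OF sets(2) fin(2)] by simp
    then show "emeasure (pos_part M V) A + emeasure \<nu> A = emeasure (neg_part M V) A + emeasure \<mu> A"
      using nn fin
      by (simp add: E[OF A] finite_measure.emeasure_eq_measure ennreal_plus[symmetric] del: ennreal_plus)
  qed
  then show ?thesis by (simp add: signed_integral_def)
qed

section \<open>Convolution monomials\<close>

definition mconv :: "'a::comm_monoid_add measure \<Rightarrow> 'a measure \<Rightarrow> 'a measure \<Rightarrow> 'a measure" where
  "mconv M \<mu> \<nu> = distr (\<mu> \<Otimes>\<^sub>M \<nu>) M (\<lambda>(x, y). x + y)"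

text \<open>The factors are listed in an arbitrary order, which \<open>mpower_mset\<close> shows to
  be immaterial. Left commutativity is established for probability measures with the sigma-algebra
  of \<open>M\<close> only, hence the detour through lists of such factors.\<close>

definition mpower :: "'a::comm_monoid_add measure \<Rightarrow> ('i \<Rightarrow> 'a measure) \<Rightarrow> 'i multiset \<Rightarrow> 'a measure" where
  "mpower M U n = foldr (\<lambda>r. mconv M (U r)) (SOME xs. mset xs = n) (return M 0)"

locale semigroup_family = measurable_abelian_semigroup M for M :: "'a::comm_monoid_add measure" +
  fixes U :: "'i \<Rightarrow> 'a measure"
  assumes prob_U: "\<And>r. prob_space (U r)" and sets_U: "\<And>r. sets (U r) = sets M"
begin

lemma mconv_prob:
  assumes "prob_space \<mu>" "sets \<mu> = sets M" "prob_space \<nu>" "sets \<nu> = sets M"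
  shows "prob_space (mconv M \<mu> \<nu>)" and "sets (mconv M \<mu> \<nu>) = sets M"
proof -
  interpret \<mu>: prob_space \<mu> by fact
  interpret \<nu>: prob_space \<nu> by fact
  interpret pair_prob_space \<mu> \<nu> ..
  have "(\<lambda>(x, y). x + y) \<in> measurable (\<mu> \<Otimes>\<^sub>M \<nu>) M"
    using add_measurable measurable_cong_sets[OF sets_pair_measure_cong[OF assms(2,4)] refl] by blast
  then show "prob_space (mconv M \<mu> \<nu>)"
    unfolding mconv_def by (rule prob_space_distr)
qed (simp add: mconv_def)

lemma nn_integral_mconv:
  assumes "prob_space \<mu>" "sets \<mu> = sets M" "prob_space \<nu>" "sets \<nu> = sets M"
    and h: "h \<in> borel_measurable M"
  shows "(\<integral>\<^sup>+z. h z \<partial>mconv M \<mu> \<nu>) = (\<integral>\<^sup>+x. \<integral>\<^sup>+y. h (x + y) \<partial>\<nu> \<partial>\<mu>)"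
proof -
  interpret \<mu>: prob_space \<mu> by fact
  interpret \<nu>: prob_space \<nu> by fact
  interpret pair_prob_space \<mu> \<nu> ..
  have m: "(\<lambda>(x, y). x + y) \<in> measurable (\<mu> \<Otimes>\<^sub>M \<nu>) M"
    using add_measurable measurable_cong_sets[OF sets_pair_measure_cong[OF assms(2,4)] refl] by blast
  have "(\<integral>\<^sup>+z. h z \<partial>mconv M \<mu> \<nu>) = (\<integral>\<^sup>+p. h (case p of (x, y) \<Rightarrow> x + y) \<partial>(\<mu> \<Otimes>\<^sub>M \<nu>))"
    unfolding mconv_def by (rule nn_integral_distr[OF m]) (simp add: h)
  also have "\<dots> = (\<integral>\<^sup>+x. \<integral>\<^sup>+y. h (x + y) \<partial>\<nu> \<partial>\<mu>)"
    using \<nu>.nn_integral_fst[OF measurable_compose[OF m h]] by simp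
  finally show ?thesis .
qed

lemma measurable_translate:
  assumes "h \<in> borel_measurable M" "x \<in> space M"
  shows "(\<lambda>y. h (x + y)) \<in> borel_measurable M"
  using measurable_compose[OF measurable_Pair1'[OF assms(2), of M] measurable_compose[OF add_measurable assms(1)]]
  by simp

lemma measurable_plus_pair:
  assumes "h \<in> borel_measurable M"
  shows "(\<lambda>(x, y). h (x + y)) \<in> borel_measurable (M \<Otimes>\<^sub>M M)"
  using measurable_compose[OF add_measurable assms] by (simp add: case_prod_unfold)

lemma measurable_nn_integral_translate:
  assumes "prob_space \<nu>" "sets \<nu> = sets M" "h \<in> borel_measurable M"
  shows "(\<lambda>x. \<integral>\<^sup>+y. h (x + y) \<partial>\<nu>) \<in> borel_measurable M"
proof -
  interpret \<nu>: prob_space \<nu> by fact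
  have "(\<lambda>(x, y). h (x + y)) \<in> borel_measurable (M \<Otimes>\<^sub>M \<nu>)"
    using measurable_plus_pair[OF assms(3)] measurable_cong_sets[OF sets_pair_measure_cong[OF refl assms(2)] refl]
    by blast
  from \<nu>.borel_measurable_nn_integral_fst[OF this] show ?thesis by simp
qed

text \<open>Both sides are the triple integral of the indicator of \<open>A\<close> at
  \<open>x + y + z\<close>, and Fubini exchanges the two outer integrals. This is the form in which
  a \<open>foldr\<close> becomes independent of the order.\<close>

lemma mconv_left_commute:
  assumes a: "prob_space a" "sets a = sets M" and b: "prob_space b" "sets b = sets M"
    and c: "prob_space c" "sets c = sets M"
  shows "mconv M a (mconv M b c) = mconv M b (mconv M a c)"
proof (rule measure_eqI)
  fix A assume "A \<in> sets (mconv M a (mconv M b c))"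
  then have A: "(indicator A :: 'a \<Rightarrow> ennreal) \<in> borel_measurable M" "A \<in> sets M"
    by (simp_all add: mconv_def)
  have *: "emeasure (mconv M a (mconv M b c)) A =
      (\<integral>\<^sup>+x. \<integral>\<^sup>+y. (\<integral>\<^sup>+z. indicator A (x + y + z) \<partial>c) \<partial>b \<partial>a)"
    if a: "prob_space a" "sets a = sets M" and b: "prob_space b" "sets b = sets M" for a b
  proof -
    have "emeasure (mconv M a (mconv M b c)) A = (\<integral>\<^sup>+z. indicator A z \<partial>mconv M a (mconv M b c))"
      using A by (simp add: mconv_def)
    also have "\<dots> = (\<integral>\<^sup>+x. \<integral>\<^sup>+y. indicator A (x + y) \<partial>mconv M b c \<partial>a)"
      by (rule nn_integral_mconv[OF a mconv_prob[OF b c] A(1)])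
    also have "\<dots> = (\<integral>\<^sup>+x. \<integral>\<^sup>+y. (\<integral>\<^sup>+z. indicator A (x + y + z) \<partial>c) \<partial>b \<partial>a)"
      using sets_eq_imp_space_eq[OF a(2)] measurable_translate[OF A(1)]
      by (intro nn_integral_cong) (simp add: nn_integral_mconv[OF b c] add.assoc)
    finally show ?thesis .
  qed
  interpret a: prob_space a by fact
  interpret b: prob_space b by fact
  interpret pair_prob_space a b ..
  have "(\<lambda>(x, y). (\<integral>\<^sup>+z. indicator A (x + y + z) \<partial>c)) \<in> borel_measurable (a \<Otimes>\<^sub>M b)"
    using measurable_plus_pair[OF measurable_nn_integral_translate[OF c A(1)]]
      measurable_cong_sets[OF sets_pair_measure_cong[OF a(2) b(2)] refl] by blast
  from Fubini'[OF this]
  show "emeasure (mconv M a (mconv M b c)) A = emeasure (mconv M b (mconv M a c)) A"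
    unfolding *[OF a b] *[OF b a] by (simp add: add.commute)
qed (simp add: mconv_def)

lemma mconv_assoc:
  assumes a: "prob_space a" "sets a = sets M" and b: "prob_space b" "sets b = sets M"
    and c: "prob_space c" "sets c = sets M"
  shows "mconv M (mconv M a b) c = mconv M a (mconv M b c)"
proof (rule measure_eqI)
  fix A assume "A \<in> sets (mconv M (mconv M a b) c)"
  then have A: "(indicator A :: 'a \<Rightarrow> ennreal) \<in> borel_measurable M" "A \<in> sets M"
    by (simp_all add: mconv_def)
  have "emeasure (mconv M (mconv M a b) c) A = (\<integral>\<^sup>+z. indicator A z \<partial>mconv M (mconv M a b) c)"
    using A by (simp add: mconv_def)
  also have "\<dots> = (\<integral>\<^sup>+x. \<integral>\<^sup>+y. (\<integral>\<^sup>+z. indicator A (x + y + z) \<partial>c) \<partial>b \<partial>a)"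
    unfolding nn_integral_mconv[OF mconv_prob[OF a b] c A(1)]
    by (rule nn_integral_mconv[OF a b measurable_nn_integral_translate[OF c A(1)]])
  also have "\<dots> = (\<integral>\<^sup>+x. \<integral>\<^sup>+y. indicator A (x + y) \<partial>mconv M b c \<partial>a)"
    using sets_eq_imp_space_eq[OF a(2)] measurable_translate[OF A(1)]
    by (intro nn_integral_cong) (simp add: nn_integral_mconv[OF b c] add.assoc)
  also have "\<dots> = emeasure (mconv M a (mconv M b c)) A"
    unfolding nn_integral_mconv[OF a mconv_prob[OF b c] A(1), symmetric] using A by (simp add: mconv_def)
  finally show "emeasure (mconv M (mconv M a b) c) A = emeasure (mconv M a (mconv M b c)) A" .
qed (simp add: mconv_def)

lemma prob_return_0: "prob_space (return M 0)"
  by (rule prob_space_return) (rule zero_in_space)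

lemma mconv_return_0:
  assumes c: "prob_space c" "sets c = sets M"
  shows "mconv M (return M 0) c = c"
proof (rule measure_eqI)
  fix A assume "A \<in> sets (mconv M (return M 0) c)"
  then have A: "(indicator A :: 'a \<Rightarrow> ennreal) \<in> borel_measurable M" "A \<in> sets M"
    by (simp_all add: mconv_def)
  have "emeasure (mconv M (return M 0) c) A = (\<integral>\<^sup>+z. indicator A z \<partial>mconv M (return M 0) c)"
    using A by (simp add: mconv_def)
  also have "\<dots> = (\<integral>\<^sup>+x. \<integral>\<^sup>+z. indicator A (x + z) \<partial>c \<partial>return M 0)"
    by (rule nn_integral_mconv[OF prob_return_0 _ c A(1)]) simp
  also have "\<dots> = emeasure c A"
    using A c measurable_nn_integral_translate[OF c A(1)] zero_in_space by (simp add: nn_integral_return)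
  finally show "emeasure (mconv M (return M 0) c) A = emeasure c A" .
qed (simp add: mconv_def assms)

lemma foldr_mconv_prob:
  "prob_space (foldr (\<lambda>r. mconv M (U r)) xs (return M 0))"
  "sets (foldr (\<lambda>r. mconv M (U r)) xs (return M 0)) = sets M"
proof (induction xs)
  case Nil
  { case 1 show ?case by (simp add: prob_return_0) next case 2 show ?case by simp }
next
  case (Cons x xs)
  { case 1 show ?case using mconv_prob[OF prob_U sets_U Cons] by simp
  next case 2 show ?case using mconv_prob[OF prob_U sets_U Cons] by simp }
qed

lemma foldr_mconv_mset:
  "mset xs = mset ys \<Longrightarrow>
    foldr (\<lambda>r. mconv M (U r)) xs (return M 0) = foldr (\<lambda>r. mconv M (U r)) ys (return M 0)"
proof (induction xs arbitrary: ys)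
  case (Cons x xs)
  have move: "foldr (\<lambda>r. mconv M (U r)) (zs @ x # ys) (return M 0) =
      mconv M (U x) (foldr (\<lambda>r. mconv M (U r)) (zs @ ys) (return M 0))" for zs ys
    by (induction zs) (simp_all add: mconv_left_commute prob_U sets_U foldr_mconv_prob flip: foldr_append)
  have "x \<in> set ys" using Cons.prems by (metis list.set_intros(1) mset_eq_setD)
  then obtain ys1 ys2 where ys: "ys = ys1 @ x # ys2" by (auto dest: split_list)
  have "mset xs = mset (ys1 @ ys2)" using Cons.prems by (simp add: ys)
  from Cons.IH[OF this] show ?case unfolding ys move by simp
qed simp

lemma mpower_mset: "mpower M U (mset xs) = foldr (\<lambda>r. mconv M (U r)) xs (return M 0)"
  unfolding mpower_def by (rule foldr_mconv_mset, rule someI[where x = xs]) simp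

lemma mpower_empty: "mpower M U {#} = return M 0"
  using mpower_mset[of "[]"] by simp

lemma mpower_add_mset: "mpower M U (add_mset r n) = mconv M (U r) (mpower M U n)"
proof -
  obtain xs where "mset xs = n" using ex_mset by blast
  then show ?thesis using mpower_mset[of "r # xs"] mpower_mset[of xs] by simp
qed

lemma prob_mpower: "prob_space (mpower M U n)"
  and sets_mpower: "sets (mpower M U n) = sets M"
  unfolding mpower_def by (rule foldr_mconv_prob)+

lemma mpower_single: "mpower M U {#r#} = U r"
proof (rule measure_eqI)
  fix A assume "A \<in> sets (mpower M U {#r#})"
  then have A: "(indicator A :: 'a \<Rightarrow> ennreal) \<in> borel_measurable M" "A \<in> sets M"
    by (simp_all add: sets_mpower)
  have "emeasure (mconv M (U r) (return M 0)) A = (\<integral>\<^sup>+z. indicator A z \<partial>mconv M (U r) (return M 0))"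
    using A by (simp add: mconv_def)
  also have "\<dots> = (\<integral>\<^sup>+x. \<integral>\<^sup>+z. indicator A (x + z) \<partial>return M 0 \<partial>U r)"
    by (rule nn_integral_mconv[OF prob_U sets_U prob_return_0 _ A(1)]) simp
  also have "\<dots> = (\<integral>\<^sup>+x. indicator A x \<partial>U r)"
    using sets_eq_imp_space_eq[OF sets_U] measurable_translate[OF A(1)] zero_in_space
    by (intro nn_integral_cong) (simp add: nn_integral_return)
  also have "\<dots> = emeasure (U r) A" using A by (simp add: sets_U)
  finally show "emeasure (mpower M U {#r#}) A = emeasure (U r) A"
    by (simp add: mpower_add_mset mpower_empty)
qed (simp add: sets_mpower sets_U)

lemma mpower_add: "mpower M U (m + n) = mconv M (mpower M U m) (mpower M U n)"
  by (induction m)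
     (simp_all add: mpower_empty mconv_return_0 prob_mpower sets_mpower mpower_add_mset mconv_assoc prob_U sets_U)

lemma measure_mpower_le: "\<bar>measure (mpower M U n) A\<bar> \<le> 1"
  using prob_space.prob_le_1[OF prob_mpower] by simp

lemma translate_set_measurable:
  assumes "A \<in> sets M" "x \<in> space M"
  shows "{y \<in> space M. x + y \<in> A} \<in> sets M"
proof -
  have "(\<lambda>y. x + y) \<in> measurable M M"
    using measurable_compose[OF measurable_Pair1'[OF assms(2), of M] add_measurable] by simp
  from measurable_sets[OF this assms(1)] show ?thesis
    by (simp add: vimage_def Int_def conj_commute)
qed

lemma measurable_measure_translate:
  assumes "A \<in> sets M" "prob_space \<nu>" "sets \<nu> = sets M" and \<mu>: "prob_space \<mu>" "sets \<mu> = sets M"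
  shows "(\<lambda>x. measure \<nu> {y \<in> space M. x + y \<in> A}) \<in> borel_measurable M"
    and "measure (mconv M \<mu> \<nu>) A = (\<integral>x. measure \<nu> {y \<in> space M. x + y \<in> A} \<partial>\<mu>)"
proof -
  interpret \<nu>: prob_space \<nu> by fact
  have A: "(indicator A :: 'a \<Rightarrow> ennreal) \<in> borel_measurable M" using assms by simp
  have eq: "(\<integral>\<^sup>+y. indicator A (x + y) \<partial>\<nu>) = ennreal (measure \<nu> {y \<in> space M. x + y \<in> A})"
    if "x \<in> space M" for x
  proof -
    have "(\<integral>\<^sup>+y. indicator A (x + y) \<partial>\<nu>) = (\<integral>\<^sup>+y. indicator {y \<in> space M. x + y \<in> A} y \<partial>\<nu>)"
      using sets_eq_imp_space_eq[OF assms(3)] by (intro nn_integral_cong) (auto simp: indicator_def)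
    also have "\<dots> = emeasure \<nu> {y \<in> space M. x + y \<in> A}"
      using translate_set_measurable[OF assms(1) that] by (simp add: assms(3))
    finally show ?thesis by (simp add: \<nu>.emeasure_eq_measure)
  qed
  have "(\<lambda>x. enn2real (\<integral>\<^sup>+y. indicator A (x + y) \<partial>\<nu>)) \<in> borel_measurable M"
    using measurable_nn_integral_translate[OF assms(2,3) A] by simp
  then show m: "(\<lambda>x. measure \<nu> {y \<in> space M. x + y \<in> A}) \<in> borel_measurable M"
    by (rule measurable_cong[THEN iffD1, rotated]) (simp add: eq)
  interpret \<mu>: prob_space \<mu> by fact
  have "emeasure (mconv M \<mu> \<nu>) A = (\<integral>\<^sup>+z. indicator A z \<partial>mconv M \<mu> \<nu>)"
    using assms by (simp add: mconv_def)
  also have "\<dots> = (\<integral>\<^sup>+x. ennreal (measure \<nu> {y \<in> space M. x + y \<in> A}) \<partial>\<mu>)"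
    unfolding nn_integral_mconv[OF \<mu> assms(2,3) A] using sets_eq_imp_space_eq[OF \<mu>(2)]
    by (intro nn_integral_cong) (simp add: eq)
  finally show "measure (mconv M \<mu> \<nu>) A = (\<integral>x. measure \<nu> {y \<in> space M. x + y \<in> A} \<partial>\<mu>)"
    using borel_measurable_sets_eq[OF m \<mu>(2)]
    by (simp add: integral_eq_nn_integral measure_def[of "mconv M \<mu> \<nu>"])
qed

end

section \<open>Signed measures given by summable coefficients\<close>

lemma abs_summable_on_real:
  fixes f :: "'b \<Rightarrow> real"
  assumes "f summable_on A"
  shows "Infinite_Set_Sum.abs_summable_on f A"
  using abs_summable_equivalent[of f A] summable_on_abs_iff[of f A] assms by simp

context semigroup_family
begin

text \<open>Different monomials may be the same measure, so a set function can have many coefficient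
  functions; only the existence of a suitable one is carried along.\<close>

definition represents :: "('a set \<Rightarrow> real) \<Rightarrow> ('i multiset \<Rightarrow> real) \<Rightarrow> bool" where
  "represents V g \<longleftrightarrow> g summable_on UNIV \<and>
    (\<forall>A\<in>sets M. V A = (\<Sum>\<^sub>\<infinity>n. g n * measure (mpower M U n) A))"

text \<open>The sum of the monomials with nonnegative weights \<open>g\<close>. As a bind over a
  discrete space it comes with its integration rule.\<close>

definition mixture :: "('i multiset \<Rightarrow> real) \<Rightarrow> 'a measure" where
  "mixture g = density (count_space UNIV) (\<lambda>n. ennreal (g n)) \<bind> mpower M U"

lemma mpower_kernel:
  "mpower M U \<in> measurable (density (count_space UNIV) f) (subprob_algebra M)"
  by (simp add: measurable_def space_subprob_algebra sets_mpower prob_mpower prob_space_imp_subprob_space)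

lemma sets_mixture: "sets (mixture g) = sets M"
  unfolding mixture_def by (rule sets_bind) (simp_all add: sets_mpower)

lemma nn_integral_mixture:
  assumes g: "g summable_on UNIV" "\<And>n. 0 \<le> g n"
    and h: "h \<in> borel_measurable M" "\<And>x. 0 \<le> h x" "\<And>x. h x \<le> B"
  shows "(\<integral>\<^sup>+x. ennreal (h x) \<partial>mixture g) = ennreal (\<Sum>\<^sub>\<infinity>n. g n * (\<integral>x. h x \<partial>mpower M U n))"
proof -
  have int: "integrable (mpower M U n) h" and hn: "0 \<le> (\<integral>x. h x \<partial>mpower M U n)"
    and hB: "(\<integral>x. h x \<partial>mpower M U n) \<le> B" for n
  proof -
    interpret prob_space "mpower M U n" by (rule prob_mpower)
    show int: "integrable (mpower M U n) h"
      using h borel_measurable_sets_eq[OF h(1) sets_mpower]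
      by (intro integrable_const_bound[where B = B]) auto
    show "0 \<le> (\<integral>x. h x \<partial>mpower M U n)" using h by simp
    show "(\<integral>x. h x \<partial>mpower M U n) \<le> B"
      using integral_mono[OF int, of "\<lambda>_. B"] h(3) by (simp add: prob_space)
  qed
  have s: "(\<lambda>n. g n * (\<integral>x. h x \<partial>mpower M U n)) summable_on UNIV"
    using hn hB by (intro summable_times_bounded[OF g(1), where B = B]) auto
  have "(\<integral>\<^sup>+x. ennreal (h x) \<partial>mixture g) =
      (\<integral>\<^sup>+n. \<integral>\<^sup>+x. ennreal (h x) \<partial>mpower M U n \<partial>density (count_space UNIV) (\<lambda>n. ennreal (g n)))"
    unfolding mixture_def using h(1) by (intro nn_integral_bind[OF _ mpower_kernel]) simp
  also have "\<dots> = (\<integral>\<^sup>+n. ennreal (g n) * (\<integral>\<^sup>+x. ennreal (h x) \<partial>mpower M U n) \<partial>count_space UNIV)"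
    by (rule nn_integral_density) simp_all
  also have "\<dots> = (\<integral>\<^sup>+n. ennreal (g n * (\<integral>x. h x \<partial>mpower M U n)) \<partial>count_space UNIV)"
    using int h g by (intro nn_integral_cong) (simp add: nn_integral_eq_integral ennreal_mult')
  also have "\<dots> = ennreal (infsetsum (\<lambda>n. g n * (\<integral>x. h x \<partial>mpower M U n)) UNIV)"
    using g hn by (intro nn_integral_conv_infsetsum abs_summable_on_real[OF s]) simp
  also have "infsetsum (\<lambda>n. g n * (\<integral>x. h x \<partial>mpower M U n)) UNIV = (\<Sum>\<^sub>\<infinity>n. g n * (\<integral>x. h x \<partial>mpower M U n))"
    by (rule infsetsum_infsum[OF abs_summable_on_real[OF s]])
  finally show ?thesis .
qed

lemma emeasure_mixture:
  assumes g: "g summable_on UNIV" "\<And>n. 0 \<le> g n" and A: "A \<in> sets M"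
  shows "emeasure (mixture g) A = ennreal (\<Sum>\<^sub>\<infinity>n. g n * measure (mpower M U n) A)"
proof -
  have "emeasure (mixture g) A = (\<integral>\<^sup>+x. ennreal (indicator A x) \<partial>mixture g)"
    using A by (simp add: sets_mixture ennreal_indicator)
  also have "\<dots> = ennreal (\<Sum>\<^sub>\<infinity>n. g n * (\<integral>x. indicator A x \<partial>mpower M U n))"
    using A by (intro nn_integral_mixture[OF g, where B = 1]) (auto simp: indicator_def)
  also have "(\<lambda>n. (\<integral>x. indicator A x \<partial>mpower M U n)) = (\<lambda>n. measure (mpower M U n) A)"
    using A sets.sets_into_space[OF A] sets_eq_imp_space_eq[OF sets_mpower]
    by (auto simp: sets_mpower Int_absorb2)
  finally show ?thesis .
qed

lemma measure_mixture:
  assumes g: "g summable_on UNIV" "\<And>n. 0 \<le> g n" and A: "A \<in> sets M"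
  shows "measure (mixture g) A = (\<Sum>\<^sub>\<infinity>n. g n * measure (mpower M U n) A)"
  unfolding measure_def[of "mixture g"] emeasure_mixture[OF assms] using g by (simp add: infsum_nonneg)

lemma finite_mixture:
  assumes g: "g summable_on UNIV" "\<And>n. 0 \<le> g n"
  shows "finite_measure (mixture g)"
  using emeasure_mixture[OF g sets.top] sets_eq_imp_space_eq[OF sets_mixture[of g]]
  by (intro finite_measureI) simp

lemma integral_mixture:
  assumes g: "g summable_on UNIV" "\<And>n. 0 \<le> g n"
    and h: "h \<in> borel_measurable M" "\<And>x. \<bar>h x\<bar> \<le> B"
  shows "(\<integral>x. h x \<partial>mixture g) = (\<Sum>\<^sub>\<infinity>n. g n * (\<integral>x. h x \<partial>mpower M U n))"
proof -
  interpret mix: finite_measure "mixture g" by (rule finite_mixture[OF g])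
  have sp: "space (mixture g) = space M" "space (mpower M U n) = space M" for n
    by (rule sets_eq_imp_space_eq, rule sets_mixture) (rule sets_eq_imp_space_eq, rule sets_mpower)
  have hB: "0 \<le> h x + B" "h x + B \<le> 2 * B" for x using h(2)[of x] by linarith+
  have int: "integrable (mixture g) h"
    using h borel_measurable_sets_eq[OF h(1) sets_mixture]
    by (intro mix.integrable_const_bound[where B = B]) auto
  have int': "integrable (mpower M U n) h" for n
    using h borel_measurable_sets_eq[OF h(1) sets_mpower] prob_space.finite_measure[OF prob_mpower]
    by (intro finite_measure.integrable_const_bound[where B = B]) auto
  have p1: "measure (mpower M U n) (space M) = 1" for n
    using prob_space.prob_space[OF prob_mpower, of n] by (simp add: sp)
  have abs: "\<bar>\<integral>x. h x \<partial>mpower M U n\<bar> \<le> B" for n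
  proof -
    interpret prob_space "mpower M U n" by (rule prob_mpower)
    have "\<bar>\<integral>x. h x \<partial>mpower M U n\<bar> \<le> (\<integral>x. \<bar>h x\<bar> \<partial>mpower M U n)" by (rule integral_abs_bound)
    also have "\<dots> \<le> (\<integral>x. B \<partial>mpower M U n)"
      using int' h(2) by (intro integral_mono) auto
    finally show ?thesis by (simp add: prob_space)
  qed
  have s: "(\<lambda>n. g n * (\<integral>x. h x \<partial>mpower M U n)) summable_on UNIV"
    using abs by (intro summable_times_bounded[OF g(1), where B = B]) auto
  have shift: "g n * (\<integral>x. h x + B \<partial>mpower M U n) = g n * (\<integral>x. h x \<partial>mpower M U n) + B * g n" for n
  proof -
    interpret prob_space "mpower M U n" by (rule prob_mpower)
    show ?thesis using int'[of n] by (simp add: prob_space distrib_left mult.commute)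
  qed
  have "(\<Sum>\<^sub>\<infinity>n. g n * (\<integral>x. h x + B \<partial>mpower M U n)) =
      (\<Sum>\<^sub>\<infinity>n. g n * (\<integral>x. h x \<partial>mpower M U n) + B * g n)"
    unfolding shift ..
  also have "\<dots> = (\<Sum>\<^sub>\<infinity>n. g n * (\<integral>x. h x \<partial>mpower M U n)) + B * (\<Sum>\<^sub>\<infinity>n. g n)"
    unfolding infsum_cmult_right'[symmetric]
    by (rule infsum_add[OF s summable_on_cmult_right[OF g(1)]])
  finally have eq: "(\<Sum>\<^sub>\<infinity>n. g n * (\<integral>x. h x + B \<partial>mpower M U n)) = \<dots>" .
  have "(\<integral>x. h x + B \<partial>mixture g) = enn2real (\<integral>\<^sup>+x. ennreal (h x + B) \<partial>mixture g)"
  proof (rule integral_eq_nn_integral)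
    show "(\<lambda>x. h x + B) \<in> borel_measurable (mixture g)"
      using int by simp
  qed (simp add: hB)
  also have "(\<integral>\<^sup>+x. ennreal (h x + B) \<partial>mixture g) = ennreal (\<Sum>\<^sub>\<infinity>n. g n * (\<integral>x. h x + B \<partial>mpower M U n))"
    by (rule nn_integral_mixture[OF g _ hB]) (use h(1) in simp)
  also have "enn2real \<dots> = (\<Sum>\<^sub>\<infinity>n. g n * (\<integral>x. h x + B \<partial>mpower M U n))"
    by (intro enn2real_ennreal infsum_nonneg mult_nonneg_nonneg g(2) Bochner_Integration.integral_nonneg hB(1))
  finally have "(\<integral>x. h x + B \<partial>mixture g) = (\<Sum>\<^sub>\<infinity>n. g n * (\<integral>x. h x \<partial>mpower M U n)) + B * (\<Sum>\<^sub>\<infinity>n. g n)"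
    unfolding eq .
  moreover have "(\<integral>x. h x + B \<partial>mixture g) = (\<integral>x. h x \<partial>mixture g) + B * measure (mixture g) (space M)"
    using int by (simp add: sp)
  moreover have "measure (mixture g) (space M) = (\<Sum>\<^sub>\<infinity>n. g n)"
    using measure_mixture[OF g sets.top] by (simp add: p1)
  ultimately show ?thesis by simp
qed

text \<open>In general not the Jordan decomposition, since the two mixtures may overlap;
  \<open>signed_integral_eq\<close> accepts it all the same.\<close>

lemma represents_mixture_diff:
  assumes "represents V g"
  defines "gp \<equiv> \<lambda>n. max (g n) 0" and "gn \<equiv> \<lambda>n. max (- g n) 0"
  shows "gp summable_on UNIV" "gn summable_on UNIV"
    and "\<forall>A\<in>sets M. V A = measure (mixture gp) A - measure (mixture gn) A"
proof -
  have g: "(\<lambda>n. \<bar>g n\<bar>) summable_on UNIV"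
    using assms(1) by (simp add: represents_def summable_on_abs_iff)
  show s: "gp summable_on UNIV" "gn summable_on UNIV"
    unfolding gp_def gn_def by (rule summable_on_comparison_test[OF g]; simp)+
  show "\<forall>A\<in>sets M. V A = measure (mixture gp) A - measure (mixture gn) A"
  proof
    fix A assume A: "A \<in> sets M"
    have "((\<lambda>n. gp n * measure (mpower M U n) A - gn n * measure (mpower M U n) A) has_sum
        (measure (mixture gp) A - measure (mixture gn) A)) UNIV"
      using A s by (intro has_sum_diff)
        (auto simp: measure_mixture gp_def gn_def intro!: has_sum_infsum summable_times_bounded[where B = 1] measure_mpower_le)
    moreover have "gp n * x - gn n * x = g n * x" for n x
      by (simp add: gp_def gn_def max_def)
    ultimately have "(\<Sum>\<^sub>\<infinity>n. g n * measure (mpower M U n) A) = measure (mixture gp) A - measure (mixture gn) A"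
      by (intro infsumI) simp
    then show "V A = measure (mixture gp) A - measure (mixture gn) A"
      using assms(1) A by (simp add: represents_def)
  qed
qed

lemma signed_integral_represents:
  assumes V: "represents V g" and h: "h \<in> borel_measurable M" "\<And>x. \<bar>h x\<bar> \<le> B"
  shows "signed_integral M V h = (\<Sum>\<^sub>\<infinity>n. g n * (\<integral>x. h x \<partial>mpower M U n))"
proof -
  note R = represents_mixture_diff[OF V]
  have abs: "\<bar>\<integral>x. h x \<partial>mpower M U n\<bar> \<le> B" for n
  proof -
    interpret prob_space "mpower M U n" by (rule prob_mpower)
    have "\<bar>\<integral>x. h x \<partial>mpower M U n\<bar> \<le> (\<integral>x. \<bar>h x\<bar> \<partial>mpower M U n)" by (rule integral_abs_bound)
    also have "\<dots> \<le> (\<integral>x. B \<partial>mpower M U n)"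
      using h(2) borel_measurable_sets_eq[OF h(1) sets_mpower] order_trans[OF abs_ge_zero h(2)[of undefined]]
      by (intro integral_mono integrable_const_bound[where B = B]) auto
    finally show ?thesis by (simp add: prob_space)
  qed
  have "signed_integral M V h =
      (\<integral>x. h x \<partial>mixture (\<lambda>n. max (g n) 0)) - (\<integral>x. h x \<partial>mixture (\<lambda>n. max (- g n) 0))"
    using R(3) h by (intro signed_integral_eq[where B = B] sets_mixture finite_mixture R(1,2)) simp_all
  also have "\<dots> = (\<Sum>\<^sub>\<infinity>n. max (g n) 0 * (\<integral>x. h x \<partial>mpower M U n)) -
      (\<Sum>\<^sub>\<infinity>n. max (- g n) 0 * (\<integral>x. h x \<partial>mpower M U n))"
    using integral_mixture[OF R(1) _ h] integral_mixture[OF R(2) _ h] by simp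
  also have "\<dots> = (\<Sum>\<^sub>\<infinity>n. max (g n) 0 * (\<integral>x. h x \<partial>mpower M U n) - max (- g n) 0 * (\<integral>x. h x \<partial>mpower M U n))"
    by (intro infsumI[symmetric] has_sum_diff has_sum_infsum summable_times_bounded[where B = B] R(1,2) abs)
  also have "\<dots> = (\<Sum>\<^sub>\<infinity>n. g n * (\<integral>x. h x \<partial>mpower M U n))"
    by (intro infsum_cong) (simp add: max_def)
  finally show ?thesis .
qed

text \<open>The norm is the value on the Hahn set minus the value on its complement. For a single
  monomial this difference lies between -1 and 1, so the series is at most the sum of the absolute
  coefficients.\<close>

lemma tv_norm_represents:
  assumes V: "represents V g"
  shows "tv_norm M V \<le> l1_norm g"
proof -
  note R = represents_mixture_diff[OF V]
  let ?m1 = "mixture (\<lambda>n. max (g n) 0)" and ?m2 = "mixture (\<lambda>n. max (- g n) 0)"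
  have fin: "finite_measure ?m1" "finite_measure ?m2"
    using R by (auto intro!: finite_mixture)
  let ?P = "hahn_set M V"
  note H = hahn_set_props[OF sets_mixture sets_mixture fin R(3)]
  note E = emeasure_pos_neg_part[OF sets_mixture sets_mixture fin R(3) sets.top]
  have P: "space M \<inter> ?P = ?P" using sets.sets_into_space[OF H(1)] by auto
  have nn: "0 \<le> V ?P" "V (space M - ?P) \<le> 0"
    using H(1) H(2)[of ?P] H(3)[of "space M - ?P"] by auto
  have gs: "g summable_on UNIV" using V by (simp add: represents_def)
  have "tv_norm M V = V ?P - V (space M - ?P)"
    using nn by (simp add: tv_norm_def measure_def E P)
  also have "\<dots> = (\<Sum>\<^sub>\<infinity>n. g n * measure (mpower M U n) ?P) - (\<Sum>\<^sub>\<infinity>n. g n * measure (mpower M U n) (space M - ?P))"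
    using V H(1) by (simp add: represents_def)
  also have "\<dots> = (\<Sum>\<^sub>\<infinity>n. g n * measure (mpower M U n) ?P - g n * measure (mpower M U n) (space M - ?P))"
    by (intro infsumI[symmetric] has_sum_diff has_sum_infsum summable_times_bounded[OF gs, where B = 1] measure_mpower_le)
  also have "\<dots> = (\<Sum>\<^sub>\<infinity>n. g n * (measure (mpower M U n) ?P - measure (mpower M U n) (space M - ?P)))"
    by (simp add: right_diff_distrib)
  also have "\<dots> \<le> l1_norm g"
  proof (rule order_trans[OF abs_ge_self abs_infsum_le_l1_norm[OF gs]])
    fix n
    show "\<bar>measure (mpower M U n) ?P - measure (mpower M U n) (space M - ?P)\<bar> \<le> 1"
      using measure_mpower_le[of n ?P] measure_mpower_le[of n "space M - ?P"]
        measure_nonneg[of "mpower M U n" ?P] measure_nonneg[of "mpower M U n" "space M - ?P"] by linarith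
  qed
  finally show ?thesis .
qed

lemma measurable_fold_fwd_diff:
  assumes "\<And>n. (\<lambda>x. \<phi> x n) \<in> borel_measurable N"
  shows "(\<lambda>x. fold (fwd_diff I) cs (\<phi> x) n) \<in> borel_measurable N"
  using assms
proof (induction cs arbitrary: \<phi>)
  case (Cons c cs)
  have "(\<lambda>x. fold (fwd_diff I) cs (fwd_diff I c (\<phi> x)) n) \<in> borel_measurable N"
    using Cons.prems unfolding fwd_diff_def[of I c]
    by (intro Cons.IH borel_measurable_sum borel_measurable_times borel_measurable_diff) auto
  then show ?case by simp
qed simp

lemma integral_fold_fwd_diff:
  assumes "\<And>n. integrable N (\<lambda>x. \<phi> x n)"
  shows "(\<integral>x. fold (fwd_diff I) cs (\<phi> x) n \<partial>N) = fold (fwd_diff I) cs (\<lambda>n. \<integral>x. \<phi> x n \<partial>N) n"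
  using assms
proof (induction cs arbitrary: \<phi>)
  case (Cons c cs)
  have "(\<integral>x. fold (fwd_diff I) cs (fwd_diff I c (\<phi> x)) n \<partial>N) =
      fold (fwd_diff I) cs (\<lambda>n. \<integral>x. fwd_diff I c (\<phi> x) n \<partial>N) n"
    using Cons.prems unfolding fwd_diff_def[of I c] by (intro Cons.IH) simp
  also have "(\<lambda>n. \<integral>x. fwd_diff I c (\<phi> x) n \<partial>N) = fwd_diff I c (\<lambda>n. \<integral>x. \<phi> x n \<partial>N)"
    using Cons.prems by (auto simp: fwd_diff_def)
  finally show ?case by simp
qed simp

lemma infsum_diff_ops_delta0_times:
  assumes "\<And>n. \<bar>\<phi> n\<bar> \<le> B"
  shows "(\<Sum>\<^sub>\<infinity>n. diff_ops I cs delta0 n * \<phi> n) = fold (fwd_diff I) cs \<phi> {#}"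
  using infsum_diff_ops_times[OF summable_delta0 assms, of I cs] infsumI[OF has_sum_delta0_times] by simp

lemma signed_integral_cong:
  assumes "\<And>x. x \<in> space M \<Longrightarrow> f x = g x"
  shows "signed_integral M V f = signed_integral M V g"
  unfolding signed_integral_def
  using assms by (intro arg_cong2[where f = "(-)"] Bochner_Integration.integral_cong)
    (auto simp: pos_part_def neg_part_def)

text \<open>Since the coefficients of \<open>V\<close> are polynomial, its value on a translate of
  \<open>A\<close> is a finite combination of monomial masses, hence measurable in \<open>x\<close>
  and integrable term by term against each \<open>mpower M U b\<close>. Every integral is the mass
  of \<open>A\<close> under a monomial whose multi-index is raised by \<open>b\<close>; transposing
  the differences back puts them on \<open>g\<close>.\<close>

lemma represents_conv:
  assumes V: "represents V (diff_ops I cs delta0)" and W: "represents W g"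
  shows "represents (conv M V W) (diff_ops I cs g)"
proof -
  have g: "g summable_on UNIV" using W by (simp add: represents_def)
  have "conv M V W A = (\<Sum>\<^sub>\<infinity>n. diff_ops I cs g n * measure (mpower M U n) A)" if A: "A \<in> sets M" for A
  proof -
    define \<phi> where "\<phi> x n = measure (mpower M U n) {y \<in> space M. x + y \<in> A}" for x n
    define h where "h x = fold (fwd_diff I) cs (\<phi> x) {#}" for x
    have \<phi>: "\<bar>\<phi> x n\<bar> \<le> 1" for x n unfolding \<phi>_def by (rule measure_mpower_le)
    have m: "(\<lambda>x. \<phi> x n) \<in> borel_measurable M" for n
      unfolding \<phi>_def
      by (rule measurable_measure_translate(1)[OF A prob_mpower sets_mpower prob_mpower sets_mpower])
    have hsum: "(\<Sum>\<^sub>\<infinity>n. diff_ops I cs delta0 n * \<phi> x n) = h x" for x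
      unfolding h_def by (rule infsum_diff_ops_delta0_times[OF \<phi>])
    have hm: "h \<in> borel_measurable M"
      unfolding h_def using m by (rule measurable_fold_fwd_diff)
    have hb: "\<bar>h x\<bar> \<le> l1_norm (diff_ops I cs delta0)" for x
      unfolding hsum[symmetric] by (rule abs_infsum_le_l1_norm[OF summable_diff_ops[OF summable_delta0] \<phi>])
    have "conv M V W A = signed_integral M W h"
      unfolding conv_def
    proof (rule signed_integral_cong)
      fix x assume "x \<in> space M"
      then have "{y \<in> space M. x + y \<in> A} \<in> sets M" by (rule translate_set_measurable[OF A])
      then show "V {y \<in> space M. x + y \<in> A} = h x"
        using V unfolding represents_def hsum[symmetric] \<phi>_def by blast
    qed
    also have "\<dots> = (\<Sum>\<^sub>\<infinity>b. g b * (\<integral>x. h x \<partial>mpower M U b))"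
      by (rule signed_integral_represents[OF W hm hb])
    also have "\<dots> = (\<Sum>\<^sub>\<infinity>b. g b * fold (fwd_diff I) cs (\<lambda>n. measure (mpower M U n) A) b)"
    proof (rule infsum_cong)
      fix b
      interpret prob_space "mpower M U b" by (rule prob_mpower)
      have "(\<integral>x. h x \<partial>mpower M U b) = fold (fwd_diff I) cs (\<lambda>n. \<integral>x. \<phi> x n \<partial>mpower M U b) {#}"
        unfolding h_def using \<phi> borel_measurable_sets_eq[OF m sets_mpower]
        by (intro integral_fold_fwd_diff integrable_const_bound[where B = 1]) auto
      also have "(\<lambda>n. \<integral>x. \<phi> x n \<partial>mpower M U b) = (\<lambda>n. measure (mpower M U (n + b)) A)"
        unfolding \<phi>_def add.commute[of _ b] mpower_add
        by (intro ext measurable_measure_translate(2)[symmetric] A prob_mpower sets_mpower)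
      also have "fold (fwd_diff I) cs (\<lambda>n. measure (mpower M U (n + b)) A) {#} =
          fold (fwd_diff I) cs (\<lambda>n. measure (mpower M U n) A) b"
        using fold_fwd_diff_translate[of I cs "\<lambda>n. measure (mpower M U n) A" b "{#}"] by simp
      finally show "g b * (\<integral>x. h x \<partial>mpower M U b) = g b * fold (fwd_diff I) cs (\<lambda>n. measure (mpower M U n) A) b"
        by simp
    qed
    also have "\<dots> = (\<Sum>\<^sub>\<infinity>n. diff_ops I cs g n * measure (mpower M U n) A)"
      by (rule infsum_diff_ops_times[OF g measure_mpower_le, symmetric])
    finally show ?thesis .
  qed
  then show ?thesis by (simp add: represents_def summable_diff_ops g)
qed

lemma represents_dirac: "represents (dirac M 0) delta0"
  by (simp add: represents_def summable_delta0 infsumI[OF has_sum_delta0_times] mpower_empty dirac_def)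

lemma represents_diff_op:
  "represents (\<lambda>A. \<Sum>r\<in>I. c r * (measure (U r) A - dirac M 0 A)) (diff_op I c delta0)"
proof -
  have "(\<Sum>\<^sub>\<infinity>n. diff_op I c delta0 n * measure (mpower M U n) A) = (\<Sum>r\<in>I. c r * (measure (U r) A - dirac M 0 A))" for A
    using infsum_diff_ops_delta0_times[of "\<lambda>n. measure (mpower M U n) A" 1 I "[c]"] measure_mpower_le
    by (simp add: fwd_diff_def mpower_empty mpower_single dirac_def)
  then show ?thesis
    by (simp add: represents_def summable_diff_op summable_delta0)
qed

lemma represents_conv_prod:
  assumes "list_all2 (\<lambda>V cs. represents V (diff_ops I cs delta0)) Vs css"
  shows "represents (conv_prod M Vs) (diff_ops I (concat css) delta0)"
  using assms unfolding conv_prod_def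
  by (induction rule: list_all2_induct) (auto simp: represents_dirac diff_ops_append intro: represents_conv)

lemma represents_conv_exp:
  assumes I: "finite I" "\<And>i. i \<in> I \<Longrightarrow> 0 < lam i"
  shows "represents (conv_exp M (\<lambda>A. \<Sum>r\<in>I. lam r * (measure (U r) A - dirac M 0 A))) (pois I lam)"
proof -
  let ?L = "\<lambda>A. \<Sum>r\<in>I. lam r * (measure (U r) A - dirac M 0 A)"
  have L: "represents (conv_power M ?L m) (diff_pow I lam m)" for m
  proof (induction m)
    case 0
    then show ?case by (simp add: diff_pow_0[where I = I and lam = lam, OF I] represents_dirac)
  next
    case (Suc m)
    then show ?case
      using represents_conv[of ?L I "[lam]"] by (simp add: diff_pow_Suc[where I = I and lam = lam, OF I] represents_diff_op)
  qed
  have "conv_exp M ?L A = (\<Sum>\<^sub>\<infinity>n. pois I lam n * measure (mpower M U n) A)" if "A \<in> sets M" for A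
  proof -
    have "conv_power M ?L m A = (\<Sum>\<^sub>\<infinity>n. diff_pow I lam m n * measure (mpower M U n) A)" for m
      using L[of m] that by (simp add: represents_def)
    then show ?thesis
      using sums_unique[OF diff_pow_exp_has_sum(2)[where I = I and lam = lam
          and \<phi> = "\<lambda>n. measure (mpower M U n) A", OF I measure_mpower_le]]
      by (simp add: conv_exp_def)
  qed
  then show ?thesis by (simp add: represents_def summable_pois[where I = I and lam = lam, OF I])
qed

end

section \<open>The norm bound\<close>

text \<open>The increments \<open>ln (m + 1)\<close> of the log-factorial increase, so both chord
  slopes are compared with \<open>ln (x + 1)\<close> at the middle point. Written without division,
  which also covers \<open>a = b\<close>.\<close>

lemma ln_fact_convex:
  assumes "a \<le> x" "x \<le> b"
  shows "(real b - real a) * ln (fact x) \<le> (real b - real x) * ln (fact a) + (real x - real a) * ln (fact b)"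
proof -
  have Suc: "ln (fact (Suc m) :: real) = ln (real m + 1) + ln (fact m)" for m
    by (simp add: ln_mult add.commute)
  have up: "ln (fact x) + (real b - real x) * ln (real x + 1) \<le> ln (fact b)"
    using assms(2)
  proof (induction b rule: dec_induct)
    case (step b)
    have "ln (real x + 1) \<le> ln (real b + 1)"
      using step by (subst ln_le_cancel_iff) auto
    moreover have "(real (Suc b) - real x) * ln (real x + 1) = ln (real x + 1) + (real b - real x) * ln (real x + 1)"
      by (simp add: algebra_simps)
    ultimately show ?case using step.IH unfolding Suc by linarith
  qed simp
  have down: "ln (fact x) \<le> ln (fact a) + (real x - real a) * ln (real x + 1)"
    using assms(1)
  proof (induction x rule: dec_induct)
    case (step x)
    have le: "ln (real x + 1) \<le> ln (real (Suc x) + 1)"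
      by (subst ln_le_cancel_iff) auto
    then have "(real x - real a) * ln (real x + 1) \<le> (real x - real a) * ln (real (Suc x) + 1)"
      using step by (intro mult_left_mono) auto
    moreover have "(real (Suc x) - real a) * ln (real (Suc x) + 1) =
        ln (real (Suc x) + 1) + (real x - real a) * ln (real (Suc x) + 1)"
      by (simp add: algebra_simps)
    ultimately show ?case using le step.IH unfolding Suc by linarith
  qed simp
  have "(real b - real x) * (ln (fact x) - ln (fact a)) \<le> (real b - real x) * ((real x - real a) * ln (real x + 1))"
    using down assms by (intro mult_left_mono) auto
  also have "\<dots> = (real x - real a) * ((real b - real x) * ln (real x + 1))" by simp
  also have "\<dots> \<le> (real x - real a) * (ln (fact b) - ln (fact x))"
    using up assms by (intro mult_left_mono) auto
  finally show ?thesis by (simp add: algebra_simps)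
qed

text \<open>
  The left side is convex in \<open>n\<close>, which reduces to \<open>n = 0\<close> and \<open>n = k - l\<close>; the latter case is convex
  in \<open>l\<close>, which reduces to \<open>l = k\<close> and to \<open>(k!)\<^sup>2 \<le> (2 k - 1)!\<close>.
\<close>

lemma ln_fact_weighted_bound:
  assumes "l + n \<le> k" "1 \<le> k"
  shows "2 * real k * ln (fact (2 * l + n)) \<le> 2 * real l * ln (fact (2 * k)) + real n * ln (fact (2 * k - 1))"
proof -
  define f where "f m = ln (fact m :: real)" for m :: nat
  have conv: "(real b - real a) * f x \<le> (real b - real x) * f a + (real x - real a) * f b"
    if "a \<le> x" "x \<le> b" for a x b
    using ln_fact_convex[OF that] by (simp add: f_def)
  have f01: "f 0 = 0" "f 1 = 0" "f (Suc 0) = 0" by (simp_all add: f_def)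
  \<comment> \<open>\<open>k\<close> is the midpoint of 1 and \<open>2 * k - 1\<close>, and the
    log-factorial vanishes at 1. For \<open>k = 1\<close> this interval degenerates.\<close>
  have s1: "2 * f k \<le> f (2 * k - 1)"
  proof (cases "k = 1")
    case False
    have "(real (2 * k - 1) - real 1) * f k \<le> (real (2 * k - 1) - real k) * f 1 + (real k - real 1) * f (2 * k - 1)"
      using assms by (intro conv) auto
    then have "(real k - 1) * (2 * f k) \<le> (real k - 1) * f (2 * k - 1)"
      using assms(2) by (simp add: f01 of_nat_diff algebra_simps)
    then show ?thesis using False assms(2) by (simp add: mult_le_cancel_left)
  qed (simp add: f_def)
  \<comment> \<open>The endpoint \<open>n = k - l\<close>, where
    \<open>2 * l + n = k + l\<close>.\<close>
  have "real k * f (k + l) \<le> (real k - real l) * f k + real l * f (2 * k)"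
    using conv[of k "k + l" "2 * k"] assms by (simp add: algebra_simps)
  moreover have "(real k - real l) * (2 * f k) \<le> (real k - real l) * f (2 * k - 1)"
    using s1 assms by (intro mult_left_mono) auto
  ultimately have s2: "2 * real k * f (k + l) \<le> (real k - real l) * f (2 * k - 1) + 2 * real l * f (2 * k)"
    by (simp add: algebra_simps)
  have s3: "2 * real k * f (2 * l) \<le> 2 * real l * f (2 * k)"
    using conv[of 0 "2 * l" "2 * k"] assms by (simp add: f01)
  show ?thesis
  proof (cases "l = k")
    case True
    then show ?thesis using s3 assms by (simp add: f_def)
  next
    case False
    then have pos: "0 < real k - real l" using assms by simp
    \<comment> \<open>Interpolation in \<open>n\<close> between the endpoints 0 and
      \<open>k - l\<close>, which coincide in the case \<open>l = k\<close> treated before.\<close>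
    have s4: "(real k - real l) * f (2 * l + n) \<le> (real k - real l - real n) * f (2 * l) + real n * f (k + l)"
      using conv[of "2 * l" "2 * l + n" "k + l"] assms by (simp add: algebra_simps)
    have "(real k - real l) * (2 * real k * f (2 * l + n)) =
        2 * real k * ((real k - real l) * f (2 * l + n))" by simp
    also have "\<dots> \<le> 2 * real k * ((real k - real l - real n) * f (2 * l) + real n * f (k + l))"
      using s4 by (intro mult_left_mono) auto
    also have "\<dots> = (real k - real l - real n) * (2 * real k * f (2 * l)) + real n * (2 * real k * f (k + l))"
      by (simp add: algebra_simps)
    also have "\<dots> \<le> (real k - real l - real n) * (2 * real l * f (2 * k)) +
        real n * ((real k - real l) * f (2 * k - 1) + 2 * real l * f (2 * k))"
      using s2 s3 assms by (intro add_mono mult_left_mono) auto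
    also have "\<dots> = (real k - real l) * (2 * real l * f (2 * k) + real n * f (2 * k - 1))"
      by (simp add: algebra_simps)
    finally have "2 * real k * f (2 * l + n) \<le> 2 * real l * f (2 * k) + real n * f (2 * k - 1)"
      using pos by (simp only: mult_le_cancel_left_pos)
    then show ?thesis by (simp add: f_def)
  qed
qed

lemma sqrt_fact_le:
  assumes "l + n \<le> k" "1 \<le> k"
  shows "sqrt (fact (2 * l + n)) \<le>
    (fact (2 * k) powr (1 / (2 * real k))) ^ l * (fact (2 * k - 1) powr (1 / (4 * real k))) ^ n"
proof -
  have "ln (sqrt (fact (2 * l + n))) = ln (fact (2 * l + n)) / 2"
    by (simp add: ln_sqrt)
  also have "\<dots> \<le> real l * (1 / (2 * real k) * ln (fact (2 * k))) + real n * (1 / (4 * real k) * ln (fact (2 * k - 1)))"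
    using ln_fact_weighted_bound[OF assms] assms(2) by (simp add: field_simps)
  also have "\<dots> = ln ((fact (2 * k) powr (1 / (2 * real k))) ^ l * (fact (2 * k - 1) powr (1 / (4 * real k))) ^ n)"
    by (simp add: ln_mult ln_realpow ln_powr)
  finally show ?thesis
    by (subst (asm) ln_le_cancel_iff) auto
qed

text \<open>The left side is the cost of the three terms of a split square, with
  \<open>\<alpha>\<close> the squared \<open>gram\<close> norm of A and \<open>s\<close>,
  \<open>\<beta>\<close> the absolute coefficient sums of A and B. The mixed term is shared out
  between the other two, and the larger of the two resulting coefficients is factored out.\<close>

lemma splitting_bound:
  fixes c c' u v w \<alpha> \<beta> s :: real
  assumes "0 \<le> c" "0 \<le> c'" "0 \<le> u" "u \<le> 1/2" "0 < v" "0 < w" "0 \<le> \<alpha>" "0 \<le> \<beta>" "0 \<le> s"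
  shows "c * \<alpha> + 4 * u * c' * \<beta> * sqrt \<alpha> + 4 * (2 * (1 - u) * s + \<beta>) * \<beta>
    \<le> max (c + c' * (u / v)) ((2 * (1 - u) + c' * u * v) * w) * (\<alpha> + 4 / w * (s + \<beta>) * \<beta>)"
proof -
  \<comment> \<open>The arithmetic-geometric mean inequality with free weight
    \<open>v\<close>.\<close>
  have "0 \<le> (sqrt \<alpha> - 2 * v * \<beta>)\<^sup>2 / v" using assms by simp
  also have "\<dots> = \<alpha> / v + 4 * v * (\<beta> * \<beta>) - 4 * \<beta> * sqrt \<alpha>"
    using assms by (simp add: power2_diff power_mult_distrib) (simp add: field_simps power2_eq_square)
  finally have "4 * \<beta> * sqrt \<alpha> \<le> \<alpha> / v + 4 * v * (\<beta> * \<beta>)" by simp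
  also have "\<dots> \<le> \<alpha> / v + 4 * v * ((s + \<beta>) * \<beta>)"
    using assms by (intro add_left_mono mult_left_mono mult_right_mono) auto
  finally have "(u * c') * (4 * \<beta> * sqrt \<alpha>) \<le> (u * c') * (\<alpha> / v + 4 * v * ((s + \<beta>) * \<beta>))"
    using assms by (intro mult_left_mono) auto
  \<comment> \<open>The bound \<open>u \<le> 1/2\<close> enters here: \<open>2 * (1 - u)\<close> is
    at least 1, so \<open>2 * (1 - u) * s + \<beta>\<close> is at most
    \<open>2 * (1 - u) * (s + \<beta>)\<close>.\<close>
  moreover have "1 * \<beta> * \<beta> \<le> (2 * (1 - u)) * \<beta> * \<beta>"
    using assms by (intro mult_right_mono) auto
  moreover have "((2 * (1 - u) + c' * u * v) * w) * (4 / w * (s + \<beta>) * \<beta>) =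
      (2 * (1 - u) + c' * u * v) * (4 * (s + \<beta>) * \<beta>)"
    using assms by simp
  ultimately have "c * \<alpha> + 4 * u * c' * \<beta> * sqrt \<alpha> + 4 * (2 * (1 - u) * s + \<beta>) * \<beta>
      \<le> (c + c' * (u / v)) * \<alpha> + ((2 * (1 - u) + c' * u * v) * w) * (4 / w * (s + \<beta>) * \<beta>)"
    using assms by (simp add: algebra_simps)
  also have "\<dots> \<le> max (c + c' * (u / v)) ((2 * (1 - u) + c' * u * v) * w) * \<alpha>
      + max (c + c' * (u / v)) ((2 * (1 - u) + c' * u * v) * w) * (4 / w * (s + \<beta>) * \<beta>)"
    using assms by (intro add_mono mult_right_mono) auto
  finally show ?thesis by (simp add: distrib_left)
qed

text \<open>
  The list \<open>as\<close> holds the \<open>A\<close>-factors already extracted: \<open>l\<close> pairs from terms \<open>A\<^sup>2\<close> and \<open>n\<close> single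
  ones from terms \<open>2 u A B\<close>.
\<close>

lemma l1_norm_squares_bound:
  fixes a b :: "'j \<Rightarrow> 'i \<Rightarrow> real"
  assumes I: "finite I" "\<And>i. i \<in> I \<Longrightarrow> 0 < lam i"
    and c: "0 \<le> c" "0 \<le> c'" "\<And>l n. l + n \<le> k \<Longrightarrow> sqrt (fact (2 * l + n)) \<le> c ^ l * c' ^ n"
    and u: "\<And>j. j \<in> set js \<Longrightarrow> 0 \<le> u j \<and> u j \<le> 1"
    and "length js + l + n \<le> k" "length as = 2 * l + n"
  shows "l1_norm (diff_ops I (concat (map (\<lambda>j. [\<lambda>r. a j r + b j r, \<lambda>r. a j r + b j r]) js) @ as) (pois I lam))
    \<le> c ^ l * c' ^ n * (\<Prod>x\<leftarrow>as. sqrt (gram I lam x x)) *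
      (\<Prod>j\<leftarrow>js. c * gram I lam (a j) (a j) + 4 * u j * c' * (\<Sum>r\<in>I. \<bar>b j r\<bar>) * sqrt (gram I lam (a j) (a j))
        + 4 * (2 * (1 - u j) * (\<Sum>r\<in>I. \<bar>a j r\<bar>) + (\<Sum>r\<in>I. \<bar>b j r\<bar>)) * (\<Sum>r\<in>I. \<bar>b j r\<bar>))"
  using assms(6-)
proof (induction js arbitrary: as l n)
  case Nil
  have "0 \<le> (\<Prod>x\<leftarrow>as. sqrt (gram I lam x x))" for as
    by (induction as) (auto simp: gram_self_nonneg I)
  then have "sqrt (fact (length as)) * (\<Prod>x\<leftarrow>as. sqrt (gram I lam x x)) \<le>
      c ^ l * c' ^ n * (\<Prod>x\<leftarrow>as. sqrt (gram I lam x x))"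
    using c(3)[of l n] Nil by (intro mult_right_mono) auto
  with l1_norm_diff_ops_pois[where I = I and lam = lam and as = as, OF I] show ?case by simp
next
  case (Cons j js)
  define \<beta> where "\<beta> j = (\<Sum>r\<in>I. \<bar>b j r\<bar>)" for j
  define s where "s j = (\<Sum>r\<in>I. \<bar>a j r\<bar>)" for j
  define \<gamma> where "\<gamma> x = sqrt (gram I lam x x)" for x
  define K where "K j = c * gram I lam (a j) (a j) + 4 * u j * c' * \<beta> j * \<gamma> (a j)
    + 4 * (2 * (1 - u j) * s j + \<beta> j) * \<beta> j" for j
  define sq where "sq = concat (map (\<lambda>j. [\<lambda>r. a j r + b j r, \<lambda>r. a j r + b j r]) js)"
  define P where "P = (\<Prod>j\<leftarrow>js. K j)"
  define Q where "Q = (\<Prod>x\<leftarrow>as. \<gamma> x)"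
  define h where "h = diff_ops I (sq @ as) (pois I lam)"
  let ?A = "diff_op I (a j)" and ?B = "diff_op I (b j)"
  have IH: "l1_norm (diff_ops I (sq @ as) (pois I lam)) \<le> c ^ l * c' ^ n * (\<Prod>x\<leftarrow>as. \<gamma> x) * P"
    if "length js + l + n \<le> k" "length as = 2 * l + n" for as l n
    using Cons.IH[OF _ that] Cons.prems(1) by (simp add: \<beta>_def s_def \<gamma>_def K_def P_def sq_def)
  have nn: "0 \<le> \<beta> j" "0 \<le> s j" "0 \<le> u j" "u j \<le> 1"
    using Cons.prems(1) by (simp_all add: \<beta>_def s_def sum_nonneg)
  have g2: "\<gamma> (a j) * \<gamma> (a j) = gram I lam (a j) (a j)"
    by (simp add: \<gamma>_def gram_self_nonneg I)
  have summ: "h summable_on UNIV" "?A h summable_on UNIV" "?B h summable_on UNIV"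
    "?A (?A h) summable_on UNIV" "?B (?A h) summable_on UNIV"
    by (auto simp: h_def intro!: summable_diff_ops summable_diff_op summable_pois I)
  have A: "?A h = diff_ops I (sq @ a j # as) (pois I lam)"
    by (simp add: h_def diff_ops_append diff_op_diff_ops_commute)
  have AA: "?A (?A h) = diff_ops I (sq @ a j # a j # as) (pois I lam)"
    unfolding A by (simp add: diff_ops_append diff_op_diff_ops_commute)
  \<comment> \<open>Extracting no factor, a single one or a pair raises \<open>l + n\<close> by at
    most one while \<open>js\<close> loses an element, so the budget \<open>k\<close> is respected
    in all three uses of \<open>IH\<close>.\<close>
  have h0: "l1_norm h \<le> c ^ l * c' ^ n * Q * P"
    unfolding h_def Q_def using Cons.prems by (intro IH) auto
  have h1: "l1_norm (?A h) \<le> c ^ l * c' ^ (n + 1) * (\<gamma> (a j) * Q) * P"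
    unfolding A using IH[of l "n + 1" "a j # as"] Cons.prems by (simp add: Q_def)
  have h2: "l1_norm (?A (?A h)) \<le> c ^ (l + 1) * c' ^ n * (\<gamma> (a j) * (\<gamma> (a j) * Q)) * P"
    unfolding AA using IH[of "l + 1" n "a j # a j # as"] Cons.prems by (simp add: Q_def)
  \<comment> \<open>The bracket of the third summand applied to \<open>h\<close>; one more
    \<open>?B\<close> completes that summand.\<close>
  define D where "D = (\<lambda>n. 2 * (1 - u j) * ?A h n + ?B h n)"
  have D: "D summable_on UNIV"
    unfolding D_def by (intro summable_on_add summable_on_cmult_right summ)
  have "l1_norm D \<le> l1_norm (\<lambda>n. 2 * (1 - u j) * ?A h n) + l1_norm (?B h)"
    unfolding D_def by (intro l1_norm_add summable_on_cmult_right summ)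
  also have "\<dots> \<le> 2 * (1 - u j) * (2 * s j * l1_norm h) + 2 * \<beta> j * l1_norm h"
    using l1_norm_diff_op[OF summ(1), of I "a j"] l1_norm_diff_op[OF summ(1), of I "b j"] nn
    unfolding l1_norm_cmult s_def \<beta>_def by (intro add_mono) (auto intro: mult_left_mono)
  also have "\<dots> = 2 * (2 * (1 - u j) * s j + \<beta> j) * l1_norm h" by (simp add: algebra_simps)
  finally have "2 * \<beta> j * l1_norm D \<le> 2 * \<beta> j * (2 * (2 * (1 - u j) * s j + \<beta> j) * l1_norm h)"
    using nn by (intro mult_left_mono) auto
  then have h3: "l1_norm (?B D) \<le> 4 * (2 * (1 - u j) * s j + \<beta> j) * \<beta> j * l1_norm h"
    using l1_norm_diff_op[OF D, of I "b j"] by (simp add: \<beta>_def algebra_simps)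
  have h4: "l1_norm (\<lambda>n. 2 * u j * ?B (?A h) n) \<le> 4 * u j * \<beta> j * l1_norm (?A h)"
    using mult_left_mono[OF l1_norm_diff_op[OF summ(2), of I "b j"], of "2 * u j"] nn
    unfolding l1_norm_cmult by (simp add: \<beta>_def algebra_simps)
  have BA: "?A (?B h) = ?B (?A h)" by (rule diff_op_commute)
  have "diff_op I (\<lambda>r. a j r + b j r) (diff_op I (\<lambda>r. a j r + b j r) h) =
      (\<lambda>n. (?A (?A h) n + 2 * u j * ?B (?A h) n) + ?B D n)"
  proof
    fix n
    have "diff_op I (\<lambda>r. a j r + b j r) (\<lambda>n. ?A h n + ?B h n) n =
        ?A (?A h) n + ?B (?A h) n + (?A (?B h) n + ?B (?B h) n)"
      unfolding diff_op_coeff_add[of I "a j"] diff_op_add ..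
    moreover have "?B D n = 2 * (1 - u j) * ?B (?A h) n + ?B (?B h) n"
      unfolding D_def diff_op_add diff_op_cmult ..
    ultimately show "diff_op I (\<lambda>r. a j r + b j r) (diff_op I (\<lambda>r. a j r + b j r) h) n =
        (?A (?A h) n + 2 * u j * ?B (?A h) n) + ?B D n"
      \<comment> \<open>The inner occurrence stands under another operator, so the pointwise rule is
        first lifted to an equation of functions.\<close>
      unfolding BA diff_op_coeff_add[of I "a j" "b j" h, THEN ext[where f = "diff_op I (\<lambda>r. a j r + b j r) h"]]
      by (simp add: algebra_simps)
  qed
  moreover have "l1_norm (\<lambda>n. (?A (?A h) n + 2 * u j * ?B (?A h) n) + ?B D n)
      \<le> (l1_norm (?A (?A h)) + l1_norm (\<lambda>n. 2 * u j * ?B (?A h) n)) + l1_norm (?B D)"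
    by (intro order_trans[OF l1_norm_add] add_right_mono l1_norm_add summable_on_add
        summable_on_cmult_right summ summable_diff_op D)
  ultimately have "l1_norm (diff_op I (\<lambda>r. a j r + b j r) (diff_op I (\<lambda>r. a j r + b j r) h))
      \<le> l1_norm (?A (?A h)) + 4 * u j * \<beta> j * l1_norm (?A h) + 4 * (2 * (1 - u j) * s j + \<beta> j) * \<beta> j * l1_norm h"
    using h3 h4 by simp
  also have "\<dots> \<le> c ^ (l + 1) * c' ^ n * (\<gamma> (a j) * (\<gamma> (a j) * Q)) * P
      + 4 * u j * \<beta> j * (c ^ l * c' ^ (n + 1) * (\<gamma> (a j) * Q) * P)
      + 4 * (2 * (1 - u j) * s j + \<beta> j) * \<beta> j * (c ^ l * c' ^ n * Q * P)"
    using h0 h1 h2 nn by (intro add_mono mult_left_mono) auto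
  also have "\<dots> = c ^ l * c' ^ n * Q * (K j * P)"
    by (simp add: K_def flip: g2) (simp add: algebra_simps)
  finally show ?case
    by (simp add: h_def sq_def P_def Q_def K_def \<beta>_def s_def \<gamma>_def)
qed

text \<open>An index below the threshold contributes its square over \<open>lam r\<close> to the
  \<open>gram\<close> term, any other contributes \<open>t\<close> times its absolute value: exactly
  the two branches of the minimum.\<close>

lemma gram_truncated:
  fixes p lam :: "'i \<Rightarrow> real" and t :: real
  defines "a \<equiv> \<lambda>r. if \<bar>p r\<bar> / lam r \<le> t then p r else 0"
    and "b \<equiv> \<lambda>r. if \<bar>p r\<bar> / lam r \<le> t then 0 else p r"
  shows "gram I lam a a + t * (\<Sum>r\<in>I. \<bar>b r\<bar>) = (\<Sum>r\<in>I. \<bar>p r\<bar> * min (\<bar>p r\<bar> / lam r) t)"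
    and "(\<Sum>r\<in>I. \<bar>a r\<bar>) + (\<Sum>r\<in>I. \<bar>b r\<bar>) = (\<Sum>r\<in>I. \<bar>p r\<bar>)"
    and "(\<lambda>r. a r + b r) = p"
  unfolding gram_def sum_distrib_left sum.distrib[symmetric] a_def b_def
  by (auto intro!: sum.cong simp: min_def abs_mult_self_eq simp flip: abs_mult)

lemma prod_list_map_mono:
  fixes f g :: "'j \<Rightarrow> real"
  assumes "\<And>j. j \<in> set js \<Longrightarrow> 0 \<le> f j \<and> f j \<le> g j"
  shows "(\<Prod>j\<leftarrow>js. f j) \<le> (\<Prod>j\<leftarrow>js. g j)"
  using assms
proof (induction js)
  case (Cons j js)
  have "0 \<le> (\<Prod>j\<leftarrow>js. f j)"
    using Cons.prems by (intro prod_list_nonneg) auto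
  moreover have "0 \<le> g j"
    using Cons.prems[of j] by auto
  ultimately show ?case
    using Cons by (auto intro!: mult_mono)
qed simp

lemma l1_norm_squares_min_bound:
  fixes p :: "'j \<Rightarrow> 'i \<Rightarrow> real"
  assumes I: "finite I" "\<And>i. i \<in> I \<Longrightarrow> 0 < lam i"
    and k: "length js = k" "1 \<le> k"
    and uvw: "\<And>j. j \<in> set js \<Longrightarrow> 0 \<le> u j \<and> u j \<le> 1/2 \<and> 0 < v j \<and> 0 < w j"
  defines "c \<equiv> fact (2 * k) powr (1 / (2 * real k))"
    and "c' \<equiv> fact (2 * k - 1) powr (1 / (4 * real k))"
  shows "l1_norm (diff_ops I (concat (map (\<lambda>j. [p j, p j]) js)) (pois I lam)) \<le>
    (\<Prod>j\<leftarrow>js. max (c + c' * (u j / v j)) ((2 * (1 - u j) + c' * u j * v j) * w j) *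
      (\<Sum>r\<in>I. \<bar>p j r\<bar> * min (\<bar>p j r\<bar> / lam r) (4 / w j * (\<Sum>r\<in>I. \<bar>p j r\<bar>))))"
proof -
  \<comment> \<open>At this threshold the last term on the right of \<open>splitting_bound\<close>
    is \<open>t j\<close> times the absolute sum of \<open>b j\<close>, as
    \<open>gram_truncated\<close> requires.\<close>
  define t where "t j = 4 / w j * (\<Sum>r\<in>I. \<bar>p j r\<bar>)" for j
  define a where "a j r = (if \<bar>p j r\<bar> / lam r \<le> t j then p j r else 0)" for j r
  define b where "b j r = (if \<bar>p j r\<bar> / lam r \<le> t j then 0 else p j r)" for j r
  note tr = gram_truncated[where lam = lam and p = "p j" and t = "t j" for j, folded a_def b_def]
  let ?K = "\<lambda>j. c * gram I lam (a j) (a j) + 4 * u j * c' * (\<Sum>r\<in>I. \<bar>b j r\<bar>) * sqrt (gram I lam (a j) (a j))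
        + 4 * (2 * (1 - u j) * (\<Sum>r\<in>I. \<bar>a j r\<bar>) + (\<Sum>r\<in>I. \<bar>b j r\<bar>)) * (\<Sum>r\<in>I. \<bar>b j r\<bar>)"
  have c0: "0 \<le> c" "0 \<le> c'" by (simp_all add: c_def c'_def)
  have "l1_norm (diff_ops I (concat (map (\<lambda>j. [\<lambda>r. a j r + b j r, \<lambda>r. a j r + b j r]) js) @ []) (pois I lam))
      \<le> c ^ 0 * c' ^ 0 * (\<Prod>x\<leftarrow>[]. sqrt (gram I lam x x)) * (\<Prod>j\<leftarrow>js. ?K j)"
    by (rule l1_norm_squares_bound[OF I c0, where k = k])
       (use uvw k sqrt_fact_le in \<open>auto simp: c_def c'_def dest!: uvw\<close>)
  then have "l1_norm (diff_ops I (concat (map (\<lambda>j. [p j, p j]) js)) (pois I lam)) \<le> (\<Prod>j\<leftarrow>js. ?K j)"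
    by (simp add: tr(3))
  also have "\<dots> \<le> (\<Prod>j\<leftarrow>js. max (c + c' * (u j / v j)) ((2 * (1 - u j) + c' * u j * v j) * w j) *
      (\<Sum>r\<in>I. \<bar>p j r\<bar> * min (\<bar>p j r\<bar> / lam r) (4 / w j * (\<Sum>r\<in>I. \<bar>p j r\<bar>))))"
  proof -
    have "0 \<le> ?K j \<and> ?K j \<le> max (c + c' * (u j / v j)) ((2 * (1 - u j) + c' * u j * v j) * w j) *
      (\<Sum>r\<in>I. \<bar>p j r\<bar> * min (\<bar>p j r\<bar> / lam r) (4 / w j * (\<Sum>r\<in>I. \<bar>p j r\<bar>)))"
      if "j \<in> set js" for j
    proof
      have j: "0 \<le> u j" "u j \<le> 1/2" "0 < v j" "0 < w j" using uvw[OF that] by auto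
      have nn: "0 \<le> gram I lam (a j) (a j)" "0 \<le> (\<Sum>r\<in>I. \<bar>b j r\<bar>)" "0 \<le> (\<Sum>r\<in>I. \<bar>a j r\<bar>)"
        by (simp_all add: gram_self_nonneg I sum_nonneg)
      show "0 \<le> ?K j"
        using j nn c0 by (intro add_nonneg_nonneg mult_nonneg_nonneg) auto
      show "?K j \<le> max (c + c' * (u j / v j)) ((2 * (1 - u j) + c' * u j * v j) * w j) *
          (\<Sum>r\<in>I. \<bar>p j r\<bar> * min (\<bar>p j r\<bar> / lam r) (4 / w j * (\<Sum>r\<in>I. \<bar>p j r\<bar>)))"
        using splitting_bound[OF c0 j nn] unfolding tr(2) tr(1)[unfolded t_def] t_def by simp
    qed
    then show ?thesis by (rule prod_list_map_mono)
  qed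
  finally show ?thesis .
qed

theorem lemma4p4:
  fixes M :: "'a::comm_monoid_add measure"
    and d k :: nat
    and p :: "nat \<Rightarrow> nat \<Rightarrow> real"
    and lam :: "nat \<Rightarrow> real"
    and U :: "nat \<Rightarrow> 'a measure"
    and W R :: "nat \<Rightarrow> 'a set \<Rightarrow> real"
    and G :: "'a set \<Rightarrow> real"
    and ps :: "nat \<Rightarrow> real"
    and c c' :: real
  assumes "measurable_abelian_semigroup M"
    and "1 \<le> d" and "1 \<le> k"
    and "\<And>r. r \<in> {1..d} \<Longrightarrow> 0 < lam r"
    and "\<And>r. r \<in> {1..d} \<Longrightarrow> prob_space (U r)"
    and "\<And>r. r \<in> {1..d} \<Longrightarrow> sets (U r) = sets M"
  defines "W \<equiv> \<lambda>r A. measure (U r) A - dirac M 0 A"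
    and "R \<equiv> \<lambda>j A. \<Sum>r=1..d. p j r * W r A"
    and "ps \<equiv> \<lambda>j. \<Sum>r=1..d. \<bar>p j r\<bar>"
    and "G \<equiv> conv_exp M (\<lambda>A. \<Sum>r=1..d. lam r * W r A)"
    and "c \<equiv> (fact (2 * k) :: real) powr (1 / (2 * real k))"
    and "c' \<equiv> (fact (2 * k - 1) :: real) powr (1 / (4 * real k))"
  shows "(\<forall>u v w :: nat \<Rightarrow> real.
            (\<forall>j\<in>{1..k}. u j \<in> {0..1/2} \<and> 0 < v j \<and> 0 < w j) \<longrightarrow>
            tv_norm M (conv M (conv_prod M (map (\<lambda>j. conv_power M (R j) 2) [1..<k+1])) G)
              \<le> (\<Prod>j=1..k.
                    max (c + c' * (u j / v j)) ((2 * (1 - u j) + c' * u j * v j) * w j)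
                    * (\<Sum>r=1..d. \<bar>p j r\<bar> * min (\<bar>p j r\<bar> / lam r) (4 / w j * ps j))))
       \<and> tv_norm M (conv M (conv_prod M (map (\<lambda>j. conv_power M (R j) 2) [1..<k+1])) G)
           \<le> sqrt (fact (2 * k)) *
               (\<Prod>j=1..k. \<Sum>r=1..d. \<bar>p j r\<bar> * min (\<bar>p j r\<bar> / lam r) (8 / c * ps j))"
proof -
  define I where "I = {1..d}"
  \<comment> \<open>\<open>semigroup_family\<close> wants a probability measure for every index, so
    the family is completed by the unit mass at 0; all sums range over \<open>I\<close>, where
    nothing changes.\<close>
  define U' where "U' r = (if r \<in> I then U r else return M 0)" for r
  interpret measurable_abelian_semigroup M by fact
  have "prob_space (U' r)" "sets (U' r) = sets M" for r
    using assms(5,6)[of r] prob_space_return[OF zero_in_space] by (simp_all add: U'_def I_def)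
  then interpret semigroup_family M U'
    by (intro semigroup_family.intro semigroup_family_axioms.intro measurable_abelian_semigroup_axioms)
  have I: "finite I" "\<And>i. i \<in> I \<Longrightarrow> 0 < lam i"
    using assms(4) by (auto simp: I_def)
  have W: "(\<Sum>r=1..d. x r * W r A) = (\<Sum>r\<in>I. x r * (measure (U' r) A - dirac M 0 A))" for x A
    by (simp add: W_def I_def U'_def)
  have R: "represents (R j) (diff_op I (p j) delta0)" for j
    unfolding R_def W by (rule represents_diff_op)
  have R2: "represents (conv_power M (R j) 2) (diff_ops I [p j, p j] delta0)" for j
    using represents_conv[of "R j" I "[p j]", OF _ represents_conv[of "R j" I "[p j]", OF _ represents_dirac]] R[of j]
    by (simp add: numeral_2_eq_2)
  let ?js = "[1..<k+1]"
  let ?V = "conv M (conv_prod M (map (\<lambda>j. conv_power M (R j) 2) ?js)) G"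
  have "represents (conv_prod M (map (\<lambda>j. conv_power M (R j) 2) ?js))
      (diff_ops I (concat (map (\<lambda>j. [p j, p j]) ?js)) delta0)"
    by (rule represents_conv_prod) (simp only: list_all2_map1 list_all2_map2, rule list_all2_refl, rule R2)
  moreover have "represents G (pois I lam)"
    unfolding G_def W using I by (rule represents_conv_exp)
  ultimately have V: "represents ?V (diff_ops I (concat (map (\<lambda>j. [p j, p j]) ?js)) (pois I lam))"
    by (rule represents_conv)
  have bound: "tv_norm M ?V \<le> (\<Prod>j=1..k. max (c + c' * (u j / v j)) ((2 * (1 - u j) + c' * u j * v j) * w j)
      * (\<Sum>r=1..d. \<bar>p j r\<bar> * min (\<bar>p j r\<bar> / lam r) (4 / w j * ps j)))"
    if uvw: "\<forall>j\<in>{1..k}. u j \<in> {0..1/2} \<and> 0 < v j \<and> 0 < w j" for u v w :: "nat \<Rightarrow> real"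
  proof -
    have js: "set ?js = {1..k}" by auto
    have "tv_norm M ?V \<le> l1_norm (diff_ops I (concat (map (\<lambda>j. [p j, p j]) ?js)) (pois I lam))"
      by (rule tv_norm_represents[OF V])
    also have "\<dots> \<le> (\<Prod>j\<leftarrow>?js. max (c + c' * (u j / v j)) ((2 * (1 - u j) + c' * u j * v j) * w j)
        * (\<Sum>r\<in>I. \<bar>p j r\<bar> * min (\<bar>p j r\<bar> / lam r) (4 / w j * (\<Sum>r\<in>I. \<bar>p j r\<bar>))))"
      unfolding c_def c'_def
      by (rule l1_norm_squares_min_bound[OF I]) (use uvw assms(3) in auto)
    also have "\<dots> = (\<Prod>j=1..k. max (c + c' * (u j / v j)) ((2 * (1 - u j) + c' * u j * v j) * w j)
        * (\<Sum>r\<in>I. \<bar>p j r\<bar> * min (\<bar>p j r\<bar> / lam r) (4 / w j * (\<Sum>r\<in>I. \<bar>p j r\<bar>))))"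
      unfolding js[symmetric] by (rule prod.distinct_set_conv_list[symmetric]) simp
    finally show ?thesis by (simp only: ps_def I_def)
  qed
  have c: "0 < c" by (simp add: c_def)
  have "c ^ k = sqrt (fact (2 * k))"
    using assms(3) by (simp add: c_def powr_realpow[symmetric] powr_powr powr_half_sqrt)
  moreover have "tv_norm M ?V \<le> (\<Prod>j=1..k. c * (\<Sum>r=1..d. \<bar>p j r\<bar> * min (\<bar>p j r\<bar> / lam r) (8 / c * ps j)))"
    \<comment> \<open>With \<open>u = 0\<close> and \<open>w = c / 2\<close> both entries of the
      maximum equal \<open>c\<close>, and \<open>4 / w\<close> becomes \<open>8 / c\<close>; the
      value 1 for \<open>v\<close> only has to be positive.\<close>
    using bound[of "\<lambda>_. 0" "\<lambda>_. 1" "\<lambda>_. c / 2"] c by simp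
  ultimately have "tv_norm M ?V \<le> sqrt (fact (2 * k)) *
      (\<Prod>j=1..k. \<Sum>r=1..d. \<bar>p j r\<bar> * min (\<bar>p j r\<bar> / lam r) (8 / c * ps j))"
    by (simp add: prod.distrib)
  with bound show ?thesis by blast
qed

end
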